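(* Let $0\le k\le d-2$, let $\alpha\in I(d,k+1)$, and let $g:\mathbb{T}^{d-(k+1)}\to\mathbb{R}$ be smooth with $\int g=0$. Define $g_\alpha(x)=g(x^\alpha)$ and $G_\alpha=\mathrm{div}^{-1}(g_\alpha)$, that is, $$G_{\alpha,j}(x)=-i\sum_{\xi\neq0}\hat g_\alpha(\xi)\frac{\xi_j}{|\xi|^2}e^{i\xi\cdot x},\qquad j=1,\dots,d.$$ Let $\beta\subset\alpha$, let $f$ be a smooth scalar function, let $\lambda\in\mathbb{N}$, and consider $$U=f\,(g_\alpha)_\lambda\,e_\beta.$$ Then the pair $$V=\frac{1}{\lambda}\sum_{i,j=1}^d\partial_if\,(G_{\alpha,j})_\lambda\,(e_\beta\wedge e_j)\llcorner dx_i,\qquad W=\frac{1}{\lambda}\sum_{j=1}^df\,(G_{\alpha,j})_\lambda\,(e_\beta\wedge e_j)$$ satisfies $$U+V=\partial W.$$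
   Context: $\mathbb{T}^m=[0,1)^m$ is the flat torus (functions on it are identified with $1$-periodic functions on $\mathbb{R}^m$); $\hat g_\alpha(\xi)=\int_{\mathbb{T}^d}g_\alpha(x)e^{-i\xi\cdot x}dx$, with frequencies $\xi$ ranging over $2\pi\mathbb{Z}^d$. For a function $h$ on the torus, $h_\lambda(x)=h(\lambda x)$. $I(d,m)$ is the set of increasing multi-indices of length $m$ in $\{1,\dots,d\}$. For $\alpha\in I(d,k+1)$, $x^\alpha\in\mathbb{R}^{d-(k+1)}$ denotes the components of $x\in\mathbb{R}^d$ whose indices are not in $\alpha$. For a multi-index $\beta=(\beta_1,\dots,\beta_m)$, $e_\beta=e_{\beta_1}\wedge\dots\wedge e_{\beta_m}$ (and $e_\emptyset=1$), where $e_1,\dots,e_d$ is the standard basis of $\mathbb{R}^d$. Contraction: for an $(l+1)$-vector $\tau$, $\tau\llcorner dx_i$ is the $l$-vector with $\langle\omega,\tau\llcorner dx_i\rangle=\langle dx_i\wedge\omega,\tau\rangle$ for all $l$-covectors $\omega$. Multivector-valued functions are identified with currents via $\langle T,\omega\rangle=\int\langle\omega(x),T(x)\rangle dx$; the boundary operator $\partial$ is the dual of the exterior derivative, $\langle\partial T,\omega\rangle=\langle T,d\omega\rangle$.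
   Formalization: With the stated conventions U+V=∂W is false (e.g. β empty gives ∂W=−(U+V)); what is proved is U+(−1)^m V=∂((−1)^{m+1}W), m the length of β, with V, W as printed, f smooth and periodic, and λ≥1. *)

theory Defs
  imports "HOL-Analysis.Analysis"
begin

text \<open>Functions on the torus \<open>[0,1)^m\<close> are 1-periodic functions on \<open>real^'m\<close>.  The index type
  \<open>'m\<close>, finite and linearly ordered, plays the role of \<open>{1,\<dots>,m}\<close>.\<close>

definition torus :: "(real^'m) set" where
  "torus = {x. \<forall>i. 0 \<le> x $ i \<and> x $ i < 1}"

definition periodic :: "(real^'m \<Rightarrow> 'b) \<Rightarrow> bool" where
  "periodic h \<longleftrightarrow> (\<forall>x i. h (x + axis i 1) = h x)"

definition torus_integral :: "(real^'m \<Rightarrow> 'b::{banach, second_countable_topology}) \<Rightarrow> 'b" where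
  "torus_integral h = set_lebesgue_integral lborel torus h"

definition dilate :: "nat \<Rightarrow> (real^'m \<Rightarrow> 'b) \<Rightarrow> real^'m \<Rightarrow> 'b" where
  "dilate l h x = h (real l *\<^sub>R x)"

definition partial :: "'m \<Rightarrow> (real^'m \<Rightarrow> 'b::real_normed_vector) \<Rightarrow> real^'m \<Rightarrow> 'b" where
  "partial i h x = vector_derivative (\<lambda>t. h (x + t *\<^sub>R axis i 1)) (at 0)"

primrec C_diff :: "nat \<Rightarrow> (real^'m \<Rightarrow> 'b::real_normed_vector) \<Rightarrow> bool" where
  "C_diff 0 h \<longleftrightarrow> continuous_on UNIV h"
| "C_diff (Suc n) h \<longleftrightarrow> (\<forall>x. h differentiable (at x)) \<and> (\<forall>i. C_diff n (partial i h))"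

definition smooth :: "(real^'m \<Rightarrow> 'b::real_normed_vector) \<Rightarrow> bool" where
  "smooth h \<longleftrightarrow> (\<forall>n. C_diff n h)"


subsection \<open>Fourier coefficients and the inverse divergence\<close>

definition freqs :: "(real^'m) set" where
  "freqs = {\<xi>. \<forall>i. \<exists>n::int. \<xi> $ i = 2 * pi * of_int n}"

definition fourier_coeff :: "(real^'m \<Rightarrow> real) \<Rightarrow> real^'m \<Rightarrow> complex" where
  "fourier_coeff h \<xi> =
     torus_integral (\<lambda>x. complex_of_real (h x) * exp (- \<i> * complex_of_real (\<xi> \<bullet> x)))"

definition div_inv_complex :: "(real^'m \<Rightarrow> real) \<Rightarrow> 'm \<Rightarrow> real^'m \<Rightarrow> complex" where
  "div_inv_complex h j x =
     - \<i> * (\<Sum>\<^sub>\<infinity>\<xi>\<in>freqs - {0}. fourier_coeff h \<xi> * complex_of_real (\<xi> $ j / (norm \<xi>)\<^sup>2)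
                                    * exp (\<i> * complex_of_real (\<xi> \<bullet> x)))"

text \<open>The series is real-valued (lemma \<open>of_real_div_inv\<close>), so taking the real part only
  changes the type.\<close>

definition div_inv :: "(real^'m \<Rightarrow> real) \<Rightarrow> 'm \<Rightarrow> real^'m \<Rightarrow> real" where
  "div_inv h j x = Re (div_inv_complex h j x)"

lemma cnj_fourier_coeff: "cnj (fourier_coeff h \<xi>) = fourier_coeff h (- \<xi>)"
proof -
  have "cnj (fourier_coeff h \<xi>) =
      (LINT x|lborel. cnj (indicator torus x *\<^sub>R
         (complex_of_real (h x) * exp (- \<i> * complex_of_real (\<xi> \<bullet> x)))))"
    unfolding fourier_coeff_def torus_integral_def set_lebesgue_integral_def
    by (rule Bochner_Integration.integral_cnj [symmetric])
  also have "\<dots> = fourier_coeff h (- \<xi>)"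
    unfolding fourier_coeff_def torus_integral_def set_lebesgue_integral_def
    by (simp add: exp_cnj)
  finally show ?thesis .
qed

lemma of_real_div_inv: "complex_of_real (div_inv h j x) = div_inv_complex h j x"
proof -
  define F where "F = (\<lambda>\<xi>. fourier_coeff h \<xi> * complex_of_real (\<xi> $ j / (norm \<xi>)\<^sup>2)
                                    * exp (\<i> * complex_of_real (\<xi> \<bullet> x)))"
  have img: "uminus ` (freqs - {0 :: real^'a}) = freqs - {0}"
  proof -
    have "- \<xi> \<in> freqs" if \<xi>: "\<xi> \<in> freqs" for \<xi> :: "real^'a"
    proof -
      have "\<exists>n::int. (- \<xi>) $ i = 2 * pi * of_int n" for i
      proof -
        obtain n :: int where "\<xi> $ i = 2 * pi * of_int n"
          using \<xi> unfolding freqs_def by blast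
        then have "(- \<xi>) $ i = 2 * pi * of_int (- n)" by simp
        then show ?thesis by blast
      qed
      then show ?thesis unfolding freqs_def by blast
    qed
    then have "\<xi> \<in> uminus ` (freqs - {0})" if "\<xi> \<in> freqs - {0}" for \<xi> :: "real^'a"
      using that by (intro image_eqI [of _ _ "- \<xi>"]) auto
    then show ?thesis using \<open>\<And>\<xi>. \<xi> \<in> freqs \<Longrightarrow> - \<xi> \<in> freqs\<close> by auto
  qed
  have "cnj (\<Sum>\<^sub>\<infinity>\<xi>\<in>freqs - {0}. F \<xi>) = (\<Sum>\<^sub>\<infinity>\<xi>\<in>freqs - {0}. cnj (F \<xi>))"
    by simp
  also have "\<dots> = (\<Sum>\<^sub>\<infinity>\<xi>\<in>freqs - {0}. - F (- \<xi>))"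
    by (rule infsum_cong) (simp add: F_def cnj_fourier_coeff exp_cnj)
  also have "\<dots> = - (\<Sum>\<^sub>\<infinity>\<xi>\<in>freqs - {0}. F (- \<xi>))"
    by (rule infsum_uminus)
  also have "(\<Sum>\<^sub>\<infinity>\<xi>\<in>freqs - {0}. F (- \<xi>)) = (\<Sum>\<^sub>\<infinity>\<xi>\<in>uminus ` (freqs - {0}). F \<xi>)"
    by (subst infsum_reindex) (auto simp: o_def)
  finally have "cnj (\<Sum>\<^sub>\<infinity>\<xi>\<in>freqs - {0}. F \<xi>) = - (\<Sum>\<^sub>\<infinity>\<xi>\<in>freqs - {0}. F \<xi>)"
    by (simp add: img)
  then have "Re (\<Sum>\<^sub>\<infinity>\<xi>\<in>freqs - {0}. F \<xi>) = 0"
    by (simp add: complex_eq_iff)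
  then show ?thesis
    unfolding div_inv_def div_inv_complex_def F_def [symmetric] by (simp add: complex_eq_iff)
qed


subsection \<open>Multivectors and covectors\<close>

text \<open>Coordinate model of the exterior algebra of \<open>real^'d\<close>: the basis vector with index
  \<open>A = {a\<^sub>1 < \<dots> < a\<^sub>l}\<close> is \<open>e\<^bsub>a\<^sub>1\<^esub> \<and> \<dots> \<and> e\<^bsub>a\<^sub>l\<^esub>\<close>, and \<open>l\<close>-vectors are supported on index sets of
  cardinality \<open>l\<close>.  Covectors are represented in the same type, by their coordinates in the dual
  basis; hence the duality pairing is the inner product, and \<open>dx\<^sub>i\<close> has the same coordinates as
  \<open>e\<^sub>i\<close>.\<close>

type_synonym 'd multivector = "real^('d set)"

definition inversions :: "'d::linorder set \<Rightarrow> 'd set \<Rightarrow> nat" where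
  "inversions A B = card {(a, b). a \<in> A \<and> b \<in> B \<and> b < a}"

definition wedge :: "'d::{finite,linorder} multivector \<Rightarrow> 'd multivector \<Rightarrow> 'd multivector"
    (infixr "\<and>\<^sub>e" 70) where
  "u \<and>\<^sub>e v = (\<chi> C. \<Sum>A\<in>Pow C. (- 1) ^ inversions A (C - A) * u $ A * v $ (C - A))"

definition e_vec :: "'d::finite \<Rightarrow> 'd multivector" where
  "e_vec i = axis {i} 1"

definition dx :: "'d::finite \<Rightarrow> 'd multivector" where
  "dx i = axis {i} 1"

definition e_multi :: "'d::{finite,linorder} list \<Rightarrow> 'd multivector" where
  "e_multi \<beta> = foldr (\<lambda>i v. e_vec i \<and>\<^sub>e v) \<beta> (axis {} 1)"

definition contract :: "'d::{finite,linorder} multivector \<Rightarrow> 'd \<Rightarrow> 'd multivector" where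
  "contract \<tau> i = adjoint (\<lambda>\<omega>. dx i \<and>\<^sub>e \<omega>) \<tau>"

lemma linear_wedge_right: "linear (\<lambda>v. u \<and>\<^sub>e v)"
  by (rule linearI)
    (simp_all add: wedge_def vec_eq_iff algebra_simps sum.distrib sum_distrib_left)

lemma inner_contract: "\<omega> \<bullet> contract \<tau> i = (dx i \<and>\<^sub>e \<omega>) \<bullet> \<tau>"
  unfolding contract_def by (rule adjoint_works [OF linear_wedge_right])

lemma contract_unique:
  assumes "\<And>\<omega>. \<omega> \<bullet> \<sigma> = (dx i \<and>\<^sub>e \<omega>) \<bullet> \<tau>"
  shows "\<sigma> = contract \<tau> i"
  using assms by (simp add: vector_eq_rdot flip: inner_contract) (metis inner_commute vector_eq_rdot)

definition multi_indices :: "nat \<Rightarrow> 'd::linorder list set" where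
  "multi_indices m = {\<beta>. length \<beta> = m \<and> sorted_wrt (<) \<beta>}"

text \<open>\<open>drop_coords \<alpha> x\<close> lists the components of \<open>x\<close> with index outside \<open>\<alpha>\<close> in increasing order;
  the component \<open>i\<close> of the result is the one whose rank among them is the rank of \<open>i\<close> in
  \<open>'n\<close>.  Meaningful for \<open>CARD('n) = CARD('d) - length \<alpha>\<close>.\<close>

definition drop_coords :: "'d::{finite,linorder} list \<Rightarrow> (real, 'd) vec \<Rightarrow> real^'n::{finite,linorder}" where
  "drop_coords \<alpha> x = (\<chi> i. x $ (sorted_list_of_set (- set \<alpha>) ! card {j. j < i}))"


subsection \<open>Forms and currents on the torus\<close>

type_synonym 'd form = "(real, 'd) vec \<Rightarrow> 'd multivector"
type_synonym 'd current = "'d form \<Rightarrow> real"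

definition test_forms :: "nat \<Rightarrow> 'd::finite form set" where
  "test_forms m = {\<omega>. smooth \<omega> \<and> periodic \<omega> \<and> (\<forall>x A. card A \<noteq> m \<longrightarrow> \<omega> x $ A = 0)}"

definition ext_deriv :: "'d::{finite,linorder} form \<Rightarrow> 'd form" where
  "ext_deriv \<omega> x = (\<Sum>i\<in>UNIV. dx i \<and>\<^sub>e partial i \<omega> x)"

definition current_of :: "((real, 'd) vec \<Rightarrow> 'd::finite multivector) \<Rightarrow> 'd current" where
  "current_of T \<omega> = torus_integral (\<lambda>x. \<omega> x \<bullet> T x)"

text \<open>With this boundary, \<open>\<partial>(h \<tau>) = - (\<Sum>i. \<partial>\<^sub>i h contract \<tau> i)\<close> for smooth periodic \<open>h\<close> and constant \<open>\<tau>\<close>;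
  moreover \<open>contract (e\<^sub>\<beta> \<and> e\<^sub>j) j = (- 1)^m e\<^sub>\<beta>\<close> for \<open>j \<notin> \<beta>\<close>, \<open>\<beta>\<close> of length \<open>m\<close>.  These two facts are the
  source of the signs in front of \<open>V\<close> and \<open>W\<close> in the homotopy identity
  \<open>U + (- 1)^m V = \<partial>((- 1)^(m + 1) W)\<close>.\<close>

definition boundary :: "'d::{finite,linorder} current \<Rightarrow> 'd current" where
  "boundary T \<omega> = T (ext_deriv \<omega>)"

end

theory Submission
  imports Defs
begin

text \<open>For smooth periodic \<open>f\<close>, \<open>\<partial>((- 1)^(m + 1) W) - (- 1)^m V\<close> is
  \<open>(- 1)^m f (\<Sum>i j. (\<partial>\<^sub>i G\<^sub>j)\<^sub>l contract (e\<^sub>\<beta> \<and> e\<^sub>j) i)\<close>.  As \<open>g\<^sub>\<alpha>\<close> does not depend on the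
  coordinates in \<open>\<alpha>\<close>, \<open>\<partial>\<^sub>i G\<^sub>j\<close> vanishes if \<open>i \<in> \<alpha>\<close> or \<open>j \<in> \<alpha>\<close>; as \<open>\<beta> \<subseteq> \<alpha>\<close>, the contractions
  with \<open>i \<noteq> j\<close> vanish for all other \<open>i\<close>, \<open>j\<close>.  The diagonal terms add up to
  \<open>(div G)\<^sub>l f e\<^sub>\<beta> = U\<close>.  Only the weak form of \<open>\<partial>\<^sub>i G\<^sub>j\<close> is needed, and it is obtained by exchanging
  integral and series, which is legitimate because the Fourier coefficients of \<open>g\<close> are absolutely
  summable.  The expansions of \<open>g\<^sub>\<alpha>\<close> come from that of \<open>g\<close> on the smaller torus,
  whose frequencies embed into those with vanishing components in \<open>\<alpha>\<close>.\<close>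

subsection \<open>Integration by parts on the torus\<close>

lemma continuous_on_cube: "continuous_on UNIV h \<Longrightarrow> continuous_on (cbox a b) h"
  by (rule continuous_on_subset) auto

lemma integrable_on_cube:
  fixes h :: "real^'m \<Rightarrow> 'b::banach"
  shows "continuous_on UNIV h \<Longrightarrow> h integrable_on cbox a b"
  by (intro integrable_continuous continuous_on_cube)

lemma torus_integral_eq_integral:
  fixes h :: "real^'m \<Rightarrow> 'b::euclidean_space"
  assumes "continuous_on UNIV h"
  shows "torus_integral h = integral (cbox 0 1) h"
proof -
  have torus_sub: "torus \<subseteq> cbox 0 (1 :: real^'m)"
    by (auto simp: torus_def mem_box_cart less_imp_le)
  have box_sub: "box 0 (1 :: real^'m) \<subseteq> torus"
    by (auto simp: torus_def mem_box_cart intro: less_imp_le)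
  have meas: "torus \<in> sets (lborel :: (real^'m) measure)"
  proof -
    have "torus = (\<Inter>i. {x :: real^'m. 0 \<le> x $ i} \<inter> {x. x $ i < 1})"
      by (auto simp: torus_def)
    also have "\<dots> \<in> sets lborel"
      by (intro sets.countable_INT'' sets.Int)
         (auto intro!: borel_closed borel_open closed_halfspace_component_ge_cart
            open_halfspace_component_lt_cart)
    finally show ?thesis .
  qed
  have "set_integrable lborel (cbox 0 1) h"
    unfolding set_integrable_def
    by (rule borel_integrable_compact) (auto intro: continuous_on_cube assms)
  then have "set_integrable lborel torus h"
    by (rule set_integrable_subset) (use meas torus_sub in auto)
  then have "torus_integral h = integral torus h"
    unfolding torus_integral_def by (rule set_borel_integral_eq_integral)
  also have "\<dots> = integral (cbox 0 1) h"
    by (rule integral_spike_set;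
        rule negligible_subset [OF negligible_frontier_interval [of 0 "1::real^'m"]])
       (use torus_sub box_sub in auto)
  finally show ?thesis .
qed

text \<open>Cut the cube at \<open>x $ k = 1 - t\<close>. Translation carries the lower slab onto
  the upper part of the cube; the upper slab leaves the cube and comes back as the lower part after
  subtracting one period.\<close>

lemma integral_cube_translate:
  fixes h :: "real^'m \<Rightarrow> 'b::banach"
  assumes cont: "continuous_on UNIV h" and per: "periodic h" and t: "0 \<le> t" "t \<le> 1"
  shows "integral (cbox 0 1) (\<lambda>x. h (x + t *\<^sub>R axis k 1)) = integral (cbox 0 1) h"
proof -
  let ?e = "axis k 1 :: real^'m"
  have e: "?e \<in> Basis" by (simp add: axis_in_Basis_iff)
  have ct: "continuous_on UNIV (\<lambda>x. h (x + t *\<^sub>R ?e))"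
    by (rule continuous_on_compose2 [OF cont]) (auto intro!: continuous_intros)
  have split: "integral (cbox 0 1) u =
      integral {x\<in>cbox 0 1. x $ k \<le> c} u + integral {x\<in>cbox 0 1. x $ k \<ge> c} u"
    if "continuous_on UNIV u" for u :: "real^'m \<Rightarrow> 'b" and c
    using integral_split [OF integrable_on_cube [OF that] e, of 0 1 c]
    by (simp add: inner_axis Int_def)
  have ax: "axis k (1::real) $ i = (if i = k then 1 else 0)" for i
    by (simp add: axis_def)
  have cbox_iff: "x \<in> cbox a b \<longleftrightarrow>
      a $ k \<le> x $ k \<and> x $ k \<le> b $ k \<and> (\<forall>i\<in>-{k}. a $ i \<le> x $ i \<and> x $ i \<le> b $ i)" for x a b :: "real^'m"
    unfolding mem_box_cart by auto
  \<comment> \<open>The slabs are written as boxes so that \<open>integral_shift_cbox\<close>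
    applies; the first two come from cutting at \<open>1 - t\<close>, the last two from cutting at
    \<open>t\<close>.\<close>
  have A: "{x\<in>cbox 0 (1::real^'m). x $ k \<le> 1 - t} = cbox (0 :: real^'m) (1 - t *\<^sub>R ?e)"
    "{x\<in>cbox 0 (1::real^'m). x $ k \<ge> 1 - t} = cbox ((1 - t) *\<^sub>R ?e) 1"
    "{x\<in>cbox 0 (1::real^'m). x $ k \<ge> t} = cbox (t *\<^sub>R ?e) 1"
    "{x\<in>cbox 0 (1::real^'m). x $ k \<le> t} = cbox 0 (1 - (1 - t) *\<^sub>R ?e)"
    using t by (auto simp: cbox_iff ax)
  have "integral (cbox 0 (1 - t *\<^sub>R ?e)) (\<lambda>x. h (x + t *\<^sub>R ?e)) = integral (cbox (t *\<^sub>R ?e) 1) h"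
    using integral_shift_cbox [of "t *\<^sub>R ?e" "t *\<^sub>R ?e" 1 h] by simp
  moreover have "integral (cbox ((1 - t) *\<^sub>R ?e) 1) (\<lambda>x. h (x + t *\<^sub>R ?e)) =
      integral (cbox 0 (1 - (1 - t) *\<^sub>R ?e)) h"
  proof -
    have "h (x + t *\<^sub>R ?e) = h (x + (t - 1) *\<^sub>R ?e)" for x
    proof -
      have "x + t *\<^sub>R ?e = (x + (t - 1) *\<^sub>R ?e) + ?e" by (simp add: algebra_simps)
      then show ?thesis using per unfolding periodic_def by metis
    qed
    then show ?thesis
      using integral_shift_cbox [of 0 "(t - 1) *\<^sub>R ?e" "1 - (1 - t) *\<^sub>R ?e" h]
      by (simp add: algebra_simps)
  qed
  ultimately show ?thesis
    using split [OF ct, of "1 - t"] split [OF cont, of t] by (simp add: A)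
qed

lemma has_derivative_imp_partial:
  assumes "(h has_derivative D) (at x)"
  shows "partial i h x = D (axis i 1)"
proof -
  have "((\<lambda>t. h (x + t *\<^sub>R axis i 1)) has_derivative (\<lambda>t. D (t *\<^sub>R axis i 1))) (at 0)"
    by (rule has_derivative_compose [where g = h and f = "\<lambda>t. x + t *\<^sub>R axis i 1"])
       (auto intro!: derivative_eq_intros assms)
  then have "((\<lambda>t. h (x + t *\<^sub>R axis i 1)) has_vector_derivative D (axis i 1)) (at 0)"
    unfolding has_vector_derivative_def
    by (simp add: linear_scale [OF has_derivative_linear [OF assms]])
  then show ?thesis unfolding partial_def by (rule vector_derivative_at)
qed

lemma has_vector_derivative_line:
  assumes "h differentiable (at (x + t *\<^sub>R axis i 1))"
  shows "((\<lambda>s. h (x + s *\<^sub>R axis i 1)) has_vector_derivative partial i h (x + t *\<^sub>R axis i 1))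
    (at t within S)"
proof -
  obtain D where D: "(h has_derivative D) (at (x + t *\<^sub>R axis i 1))"
    using assms unfolding differentiable_def by blast
  have "((\<lambda>s. h (x + s *\<^sub>R axis i 1)) has_derivative (\<lambda>s. D (s *\<^sub>R axis i 1))) (at t within S)"
    by (rule has_derivative_compose [where g = h and f = "\<lambda>t. x + t *\<^sub>R axis i 1"])
       (auto intro!: derivative_eq_intros D)
  then show ?thesis
    unfolding has_vector_derivative_def has_derivative_imp_partial [OF D]
    by (simp add: linear_scale [OF has_derivative_linear [OF D]])
qed

lemma C_diff_1: "C_diff 1 h \<longleftrightarrow>
    (\<forall>x. h differentiable (at x)) \<and> (\<forall>i. continuous_on UNIV (partial i h))"
  by simp

lemma C_diff_1_imp_continuous: "C_diff 1 h \<Longrightarrow> continuous_on UNIV h"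
  by (auto simp: continuous_on_eq_continuous_at intro: differentiable_imp_continuous_within)

lemma partial_bounded_linear:
  assumes "bounded_linear T" "h differentiable (at x)"
  shows "partial i (\<lambda>x. T (h x)) x = T (partial i h x)"
proof -
  obtain D where D: "(h has_derivative D) (at x)"
    using assms(2) unfolding differentiable_def by blast
  have "((\<lambda>x. T (h x)) has_derivative (\<lambda>v. T (D v))) (at x)"
    by (rule bounded_linear.has_derivative [OF assms(1) D])
  then show ?thesis by (simp add: has_derivative_imp_partial [OF D] has_derivative_imp_partial)
qed

lemma C_diff_1_bounded_linear:
  assumes "bounded_linear T" "C_diff 1 h"
  shows "C_diff 1 (\<lambda>x. T (h x))"
proof -
  have "partial i (\<lambda>x. T (h x)) = (\<lambda>x. T (partial i h x))" for i
    using assms by (intro ext partial_bounded_linear) auto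
  moreover have "(\<lambda>x. T (h x)) differentiable (at x)" for x
    using assms(2) bounded_linear.has_derivative [OF assms(1)] unfolding C_diff_1 differentiable_def
    by blast
  ultimately show ?thesis
    using assms(2) by (auto intro!: bounded_linear.continuous_on [OF assms(1)])
qed

lemma partial_bilinear:
  assumes "bounded_bilinear op" "u differentiable (at x)" "v differentiable (at x)"
  shows "partial i (\<lambda>x. op (u x) (v x)) x = op (u x) (partial i v x) + op (partial i u x) (v x)"
proof -
  obtain D E where D: "(u has_derivative D) (at x)" and E: "(v has_derivative E) (at x)"
    using assms(2,3) unfolding differentiable_def by blast
  show ?thesis
    by (simp add: has_derivative_imp_partial [OF D] has_derivative_imp_partial [OF E]
        has_derivative_imp_partial [OF bounded_bilinear.FDERIV [OF assms(1) D E]])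
qed

text \<open>First order is enough because products are only ever integrated by parts once. The
  general bilinear form covers real products as well as real multiples of complex functions.\<close>

lemma C_diff_1_bilinear:
  assumes "bounded_bilinear op" "C_diff 1 u" "C_diff 1 v"
  shows "C_diff 1 (\<lambda>x. op (u x) (v x))"
proof -
  have "partial i (\<lambda>x. op (u x) (v x)) =
      (\<lambda>x. op (u x) (partial i v x) + op (partial i u x) (v x))" for i
    using assms by (intro ext partial_bilinear) auto
  moreover have "(\<lambda>x. op (u x) (v x)) differentiable (at x)" for x
    using assms(2,3) bounded_bilinear.FDERIV [OF assms(1)] unfolding C_diff_1 differentiable_def
    by blast
  ultimately show ?thesis
    using assms C_diff_1_imp_continuous [OF assms(2)] C_diff_1_imp_continuous [OF assms(3)]
    by (auto intro!: continuous_intros bounded_bilinear.continuous_on [OF assms(1)])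
qed

lemma periodic_partial:
  assumes "periodic h" shows "periodic (partial i h)"
proof -
  have "h (x + axis j 1 + t *\<^sub>R axis i 1) = h (x + t *\<^sub>R axis i 1)" for x j t
    using assms unfolding periodic_def by (metis add.assoc add.commute)
  then show ?thesis unfolding periodic_def partial_def by simp
qed

text \<open>Averaging \<open>\<partial>\<^sub>i h\<close> over all translates in direction \<open>i\<close> turns the inner integral into
  \<open>h (x + e\<^sub>i) - h x = 0\<close>.\<close>

lemma integral_partial_eq_0:
  fixes h :: "real^'m \<Rightarrow> 'b::banach"
  assumes h: "C_diff 1 h" and per: "periodic h"
  shows "integral (cbox 0 1) (partial i h) = 0"
proof -
  let ?p = "partial i h"
  have cp: "continuous_on UNIV ?p" using h by simp
  have "integral (cbox 0 1) ?p = integral (cbox 0 (1::real)) (\<lambda>t. integral (cbox 0 1) ?p)"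
    by simp
  also have "\<dots> = integral (cbox 0 (1::real)) (\<lambda>t. integral (cbox 0 1) (\<lambda>x. ?p (x + t *\<^sub>R axis i 1)))"
    by (rule integral_cong) (simp add: integral_cube_translate [OF cp periodic_partial [OF per]])
  also have "\<dots> = integral (cbox 0 1) (\<lambda>x. integral (cbox 0 (1::real)) (\<lambda>t. ?p (x + t *\<^sub>R axis i 1)))"
    by (rule integral_swap_continuous, unfold split_beta,
        rule continuous_on_compose2 [OF cp]) (auto intro!: continuous_intros)
  also have "\<dots> = integral (cbox 0 (1 :: real^'m)) (\<lambda>x. 0)"
  proof (rule integral_cong)
    fix x
    have "((\<lambda>t. ?p (x + t *\<^sub>R axis i 1)) has_integral
        h (x + 1 *\<^sub>R axis i 1) - h (x + 0 *\<^sub>R axis i 1)) {0..1}"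
      by (rule fundamental_theorem_of_calculus)
         (use h in \<open>auto intro: has_vector_derivative_line\<close>)
    then show "integral (cbox 0 (1::real)) (\<lambda>t. ?p (x + t *\<^sub>R axis i 1)) = 0"
      using per by (simp add: periodic_def integral_unique)
  qed
  finally show ?thesis by simp
qed

text \<open>The product rule is integrated over the cube. There is no boundary term, since the
  product is again periodic and \<open>integral_partial_eq_0\<close> applies.\<close>

lemma integral_by_parts_cube:
  fixes op :: "'a::banach \<Rightarrow> 'b::banach \<Rightarrow> 'c::banach" and u :: "real^'m \<Rightarrow> 'a"
  assumes op: "bounded_bilinear op" and u: "C_diff 1 u" "periodic u"
    and v: "C_diff 1 v" "periodic v"
  shows "integral (cbox 0 1) (\<lambda>x. op (partial i u x) (v x)) =
    - integral (cbox 0 1) (\<lambda>x. op (u x) (partial i v x))"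
proof -
  have cont: "continuous_on UNIV (\<lambda>x. op (u x) (partial i v x))"
    "continuous_on UNIV (\<lambda>x. op (partial i u x) (v x))"
    using u v C_diff_1_imp_continuous [OF u(1)] C_diff_1_imp_continuous [OF v(1)]
    by (auto intro!: bounded_bilinear.continuous_on [OF op])
  have "0 = integral (cbox 0 1) (partial i (\<lambda>x. op (u x) (v x)))"
    by (rule integral_partial_eq_0 [symmetric])
       (use C_diff_1_bilinear [OF op u(1) v(1)] u v in \<open>auto simp: periodic_def\<close>)
  also have "\<dots> = integral (cbox 0 1) (\<lambda>x. op (u x) (partial i v x) + op (partial i u x) (v x))"
    using u v by (intro integral_cong partial_bilinear [OF op]) auto
  also have "\<dots> = integral (cbox 0 1) (\<lambda>x. op (u x) (partial i v x)) +
      integral (cbox 0 1) (\<lambda>x. op (partial i u x) (v x))"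
    by (intro integral_add integrable_on_cube cont)
  finally show ?thesis by (simp add: eq_neg_iff_add_eq_0 add.commute)
qed


subsection \<open>Trigonometric monomials and uniqueness of Fourier coefficients\<close>

definition wave :: "real^'m \<Rightarrow> real^'m \<Rightarrow> complex" where
  "wave \<xi> x = exp (\<i> * complex_of_real (\<xi> \<bullet> x))"

lemma norm_wave [simp]: "norm (wave \<xi> x) = 1"
  by (simp add: wave_def)

lemma wave_add: "wave (\<xi> + \<eta>) x = wave \<xi> x * wave \<eta> x"
  by (simp add: wave_def inner_add_left algebra_simps flip: exp_add)

lemma wave_0 [simp]: "wave 0 x = 1"
  by (simp add: wave_def)

lemma wave_scaleR_right: "wave \<xi> (c *\<^sub>R x) = wave (c *\<^sub>R \<xi>) x"
  by (simp add: wave_def)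

lemma cnj_wave: "cnj (wave \<xi> x) = wave (- \<xi>) x"
  by (simp add: wave_def exp_cnj)

lemma continuous_on_wave [continuous_intros]:
  "continuous_on S u \<Longrightarrow> continuous_on S (\<lambda>x. wave \<xi> (u x))"
  unfolding wave_def by (intro continuous_intros)

lemma partial_wave: "partial i (wave \<xi>) x = \<i> * complex_of_real (\<xi> $ i) * wave \<xi> x"
  and differentiable_wave: "wave \<xi> differentiable (at x)"
proof -
  have "((\<lambda>x. exp (\<i> * complex_of_real (\<xi> \<bullet> x))) has_derivative
      (\<lambda>v. \<i> * complex_of_real (\<xi> \<bullet> v) * wave \<xi> x)) (at x)"
  proof -
    have "((\<lambda>x. \<i> * complex_of_real (\<xi> \<bullet> x)) has_derivative (\<lambda>v. \<i> * complex_of_real (\<xi> \<bullet> v))) (at x)"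
      by (intro has_derivative_mult_right has_derivative_of_real has_derivative_inner_right
          has_derivative_ident)
    from has_derivative_compose [OF this DERIV_exp [THEN has_field_derivative_imp_has_derivative]]
    show ?thesis by (simp add: wave_def mult.commute)
  qed
  then have "(wave \<xi> has_derivative (\<lambda>v. \<i> * complex_of_real (\<xi> \<bullet> v) * wave \<xi> x)) (at x)"
    by (simp add: wave_def [abs_def])
  then show "partial i (wave \<xi>) x = \<i> * complex_of_real (\<xi> $ i) * wave \<xi> x"
    and "wave \<xi> differentiable (at x)"
    by (auto simp: has_derivative_imp_partial inner_axis differentiable_def)
qed

lemma C_diff_1_wave: "C_diff 1 (wave \<xi>)"
  using differentiable_wave [of \<xi>] partial_wave [of _ \<xi>]
  by (auto simp: cong: continuous_on_cong intro!: continuous_intros)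

lemma zero_in_freqs [simp]: "0 \<in> freqs"
  by (auto simp: freqs_def intro!: exI [of _ 0])

lemma freqs_add: "\<xi> \<in> freqs \<Longrightarrow> \<eta> \<in> freqs \<Longrightarrow> \<xi> + \<eta> \<in> freqs"
  unfolding freqs_def by (auto simp: ring_distribs) (metis distrib_left of_int_add)

lemma freqs_uminus: "\<xi> \<in> freqs \<Longrightarrow> - \<xi> \<in> freqs"
  unfolding freqs_def by auto (metis mult_minus_right of_int_minus)

lemma freqs_scaleR_of_nat: "\<xi> \<in> freqs \<Longrightarrow> real l *\<^sub>R \<xi> \<in> freqs"
  by (induction l) (auto simp: scaleR_add_left freqs_add)

lemma freqs_axis: "axis j (2 * pi) \<in> freqs"
  unfolding freqs_def axis_def by (auto intro: exI [of _ 0] exI [of _ 1])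

lemma wave_axis_2pi: "wave (axis j (2 * pi)) x = cis (2 * pi * x $ j)"
  by (simp add: wave_def cis_conv_exp inner_axis' mult.commute)

lemma periodic_wave: "\<xi> \<in> freqs \<Longrightarrow> periodic (wave \<xi>)"
proof -
  assume "\<xi> \<in> freqs"
  then have "exp (\<i> * complex_of_real (\<xi> $ i)) = 1" for i
    unfolding freqs_def exp_eq_1 by (auto simp: mult.commute mult.left_commute)
  then show ?thesis
    by (simp add: periodic_def wave_def inner_add_right inner_axis distrib_left exp_add)
qed

lemma content_unit_cube [simp]: "measure lborel (cbox 0 (1 :: real^'m)) = 1"
  by (subst content_cbox_cart) (auto simp: interval_eq_empty_cart)

text \<open>Orthogonality of characters: if some component of \<xi> is nonzero, the wave is a
  constant multiple of one of its own partial derivatives, and these integrate to zero.\<close>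

lemma integral_wave:
  fixes \<xi> :: "real^'m"
  assumes "\<xi> \<in> freqs"
  shows "integral (cbox 0 1) (wave \<xi>) = (if \<xi> = 0 then 1 else 0)"
proof (cases "\<xi> = 0")
  case True
  then show ?thesis by (simp add: True wave_def [abs_def])
next
  case False
  then obtain i where i: "\<xi> $ i \<noteq> 0" by (auto simp: vec_eq_iff)
  have "0 = integral (cbox 0 1) (partial i (wave \<xi>))"
    by (rule integral_partial_eq_0 [symmetric]) (intro C_diff_1_wave periodic_wave assms)+
  also have "\<dots> = \<i> * complex_of_real (\<xi> $ i) * integral (cbox 0 1) (wave \<xi>)"
    by (simp add: partial_wave [abs_def])
  finally show ?thesis using i False by simp
qed

section \<open>Uniqueness: a continuous periodic function with vanishing Fourier coefficients is
  zero\<close>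

lemma periodic_reduce:
  assumes "periodic h"
  shows "\<exists>y\<in>torus. h y = h x"
proof -
  have shift: "h (z + of_int n *\<^sub>R axis i 1) = h z" for z n i
  proof (induction n rule: int_induct [where k = 0])
    case (step1 n)
    have "z + of_int (n + 1) *\<^sub>R axis i 1 = (z + of_int n *\<^sub>R axis i 1) + axis i 1"
      by (simp add: algebra_simps)
    then show ?case using step1 assms unfolding periodic_def by metis
  next
    case (step2 n)
    have "z + of_int n *\<^sub>R axis i 1 = (z + of_int (n - 1) *\<^sub>R axis i 1) + axis i 1"
      by (simp add: algebra_simps)
    then show ?case using step2 assms unfolding periodic_def by metis
  qed simp
  \<comment> \<open>The coordinates are brought into the unit interval one at a time by subtracting
    their floors, hence the induction over the set \<open>I\<close> of coordinates already
    treated.\<close>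
  have "\<exists>y. h y = h x \<and> (\<forall>i\<in>I. 0 \<le> y $ i \<and> y $ i < 1)" if "finite I" for I
    using that
  proof induction
    case (insert i I)
    then obtain y where y: "h y = h x" "\<forall>i\<in>I. 0 \<le> y $ i \<and> y $ i < 1" by blast
    let ?y = "y + of_int (- \<lfloor>y $ i\<rfloor>) *\<^sub>R axis i 1"
    have "0 \<le> ?y $ j \<and> ?y $ j < 1" if "j \<in> insert i I" for j
      using that y(2) insert.hyps by (auto simp: axis_def) linarith
    then show ?case using shift y(1) by metis
  qed auto
  from this [of UNIV] show ?thesis by (auto simp: torus_def)
qed

context
  fixes h :: "real^'m \<Rightarrow> real"
  assumes cont: "continuous_on UNIV h"
    and orth: "\<And>\<xi>. \<xi> \<in> freqs \<Longrightarrow>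
      integral (cbox 0 1) (\<lambda>x. complex_of_real (h x) * wave \<xi> x) = 0"
begin

text \<open>The bump is a trigonometric polynomial. Let \<open>P p\<close> say that
  \<open>h * p\<close> is orthogonal to all waves: this property survives multiplication by each
  cosine factor, because a cosine only shifts the frequency by plus or minus
  \<open>axis j (2 * pi)\<close>.\<close>

lemma orthogonal_bump_power:
  fixes a :: "real^'m"
  shows "integral (cbox 0 1) (\<lambda>x. h x * (\<Prod>j\<in>UNIV. (1 + cos (2 * pi * (x $ j - a $ j))) / 2) ^ N) = 0"
proof -
  define P where "P p \<longleftrightarrow> continuous_on UNIV p \<and> (\<forall>\<xi>\<in>freqs.
      integral (cbox 0 1) (\<lambda>x. complex_of_real (h x * p x) * wave \<xi> x) = 0)" for p :: "real^'m \<Rightarrow> real"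
  let ?t = "\<lambda>j x. (1 + cos (2 * pi * (x $ j - a $ j))) / 2"
  have step: "P (\<lambda>x. ?t j x * p x)" if p: "P p" for p j
  proof -
    let ?\<eta> = "axis j (2 * pi) :: real^'m"
    let ?c = "cis (2 * pi * a $ j)"
    let ?I = "\<lambda>\<xi> x. complex_of_real (h x * p x) * wave \<xi> x"
    \<comment> \<open>Euler's formula for the cosine; the phase \<open>a $ j\<close> goes into
      constant coefficients.\<close>
    have t: "complex_of_real (?t j x) = 1/2 + cnj ?c / 4 * wave ?\<eta> x + ?c / 4 * wave (- ?\<eta>) x" for x
    proof -
      have "complex_of_real ((1 + cos (u - v)) / 2) =
          1/2 + cnj (cis v) / 4 * cis u + cis v / 4 * cnj (cis u)" for u v :: real
        by (auto simp: complex_eq_iff cos_diff field_simps)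
      then show ?thesis
        by (simp only: wave_axis_2pi cnj_wave [symmetric] right_diff_distrib)
    qed
    have c: "continuous_on UNIV (\<lambda>x. k * ?I \<xi> x)" for \<xi> k
      using p by (auto simp: P_def intro!: continuous_intros cont)
    have "integral (cbox 0 1) (\<lambda>x. complex_of_real (h x * (?t j x * p x)) * wave \<xi> x) = 0"
      if \<xi>: "\<xi> \<in> freqs" for \<xi>
    proof -
      have "complex_of_real (h x * (?t j x * p x)) * wave \<xi> x =
          1/2 * ?I \<xi> x + cnj ?c / 4 * ?I (\<xi> + ?\<eta>) x + ?c / 4 * ?I (\<xi> + - ?\<eta>) x" for x
        unfolding of_real_mult t wave_add by (simp add: algebra_simps)
      then have "integral (cbox 0 1) (\<lambda>x. complex_of_real (h x * (?t j x * p x)) * wave \<xi> x) =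
          integral (cbox 0 1) (\<lambda>x. 1/2 * ?I \<xi> x + cnj ?c / 4 * ?I (\<xi> + ?\<eta>) x + ?c / 4 * ?I (\<xi> + - ?\<eta>) x)"
        by (simp only:)
      also have "\<dots> = integral (cbox 0 1) (\<lambda>x. 1/2 * ?I \<xi> x) +
          integral (cbox 0 1) (\<lambda>x. cnj ?c / 4 * ?I (\<xi> + ?\<eta>) x) +
          integral (cbox 0 1) (\<lambda>x. ?c / 4 * ?I (\<xi> + - ?\<eta>) x)"
        by (subst integral_add, (intro integrable_add integrable_on_cube c)+)
          (subst integral_add, (intro integrable_on_cube c)+, rule refl)
      also have "\<dots> = 0"
        using p \<xi> by (simp only: integral_mult_right P_def freqs_add freqs_uminus freqs_axis) simp
      finally show ?thesis .
    qed
    then show ?thesis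
      using p by (auto simp: P_def intro!: continuous_intros)
  qed
  have prod: "P (\<lambda>x. (\<Prod>j\<in>I. ?t j x) * p x)" if "P p" "finite I" for p I
    using that(2)
  proof induction
    case (insert j I)
    then show ?case using step [OF insert.IH, of j] by (simp add: mult.assoc)
  qed (use that in simp)
  have "P (\<lambda>x. (\<Prod>j\<in>UNIV. ?t j x) ^ N)"
  proof (induction N)
    case 0
    then show ?case using orth by (simp add: P_def)
  next
    case (Suc N)
    then show ?case using prod [OF Suc, of UNIV] by simp
  qed
  then have "integral (cbox 0 1) (\<lambda>x. complex_of_real (h x * (\<Prod>j\<in>UNIV. ?t j x) ^ N)) = 0"
    unfolding P_def by (auto dest!: bspec [of _ _ 0])
  moreover have "(\<lambda>x. h x * (\<Prod>j\<in>UNIV. ?t j x) ^ N) integrable_on cbox 0 1"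
    by (intro integrable_on_cube continuous_intros cont) auto
  ultimately show ?thesis
    using integral_linear [OF _ bounded_linear_of_real [where 'a = complex],
        of "\<lambda>x. h x * (\<Prod>j\<in>UNIV. ?t j x) ^ N" "cbox 0 1"]
    by (simp add: o_def)
qed

text \<open>The powers of \<open>\<Prod>\<^sub>j (1 + cos (2\<pi> (x\<^sub>j - a\<^sub>j))) / 2\<close> concentrate at \<open>a\<close>, relative to
  their size away from \<open>a\<close>.\<close>

lemma orthogonal_imp_nonpos:
  assumes a: "a \<in> box 0 1"
  shows "h a \<le> 0"
proof (rule ccontr)
  assume "\<not> h a \<le> 0"
  then have pos: "h a > 0" by simp
  define T where "T x = (\<Prod>j\<in>UNIV. (1 + cos (2 * pi * (x $ j - a $ j))) / 2)" for x :: "real^'m"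
  have contT: "continuous_on S T" for S
    unfolding T_def by (intro continuous_intros) auto
  have t01: "0 \<le> (1 + cos z) / 2" "(1 + cos z) / 2 \<le> 1" for z :: real
    using cos_ge_minus_one [of z] cos_le_one [of z]
    by (auto simp: field_simps simp del: cos_ge_minus_one cos_le_one)
  have T0: "0 \<le> T x" for x
    unfolding T_def by (intro prod_nonneg ballI t01)
  \<comment> \<open>As \<open>a\<close> is interior, coordinates of \<open>x\<close> and
    \<open>a\<close> differ by less than a full period, so a cosine can equal 1 only where the
    coordinates agree. On the boundary of the cube \<open>a\<close> would have other copies.\<close>
  have T1: "T x < 1" if x: "x \<in> cbox 0 1" "x \<noteq> a" for x
  proof -
    obtain j where j: "x $ j \<noteq> a $ j" using x(2) by (auto simp: vec_eq_iff)
    have "0 \<le> x $ j" "x $ j \<le> 1" "0 < a $ j" "a $ j < 1"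
      using x(1) a by (auto simp: mem_box_cart)
    then have "\<bar>x $ j - a $ j\<bar> < 1" by linarith
    have "cos (2 * pi * (x $ j - a $ j)) \<noteq> 1"
    proof
      assume "cos (2 * pi * (x $ j - a $ j)) = 1"
      then obtain n :: int where "x $ j - a $ j = n"
        by (auto simp: cos_one_2pi_int)
      moreover have "\<bar>n\<bar> < 1"
        using calculation \<open>\<bar>x $ j - a $ j\<bar> < 1\<close> by linarith
      ultimately show False using j by simp
    qed
    then have "(1 + cos (2 * pi * (x $ j - a $ j))) / 2 < 1"
      by (simp add: less_le)
    moreover have "T x \<le> (1 + cos (2 * pi * (x $ j - a $ j))) / 2"
      unfolding T_def
      by (subst prod.remove [of _ j], simp, simp) (intro mult_left_le prod_le_1 conjI t01)
    ultimately show ?thesis by simp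
  qed
  have Ta: "T a = 1" by (simp add: T_def)
  have "isCont h a" using cont by (simp add: continuous_on_eq_continuous_at)
  then obtain \<rho> where \<rho>: "\<rho> > 0" "\<And>x. dist x a < \<rho> \<Longrightarrow> h x > h a / 2"
  proof -
    have "h a / 2 > 0" using pos by simp
    with \<open>isCont h a\<close> obtain \<rho> where "\<rho> > 0" "\<forall>x. dist x a < \<rho> \<longrightarrow> dist (h x) (h a) < h a / 2"
      unfolding continuous_at_eps_delta by blast
    moreover have "h x > h a / 2" if "dist (h x) (h a) < h a / 2" for x
      using that unfolding dist_real_def by (simp only: abs_diff_less_iff) linarith
    ultimately show thesis using that by blast
  qed
  obtain M where M: "M > 0" "\<And>x. x \<in> cbox 0 1 \<Longrightarrow> \<bar>h x\<bar> \<le> M"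
  proof -
    have "bounded (h ` cbox 0 1)"
      by (intro compact_imp_bounded compact_continuous_image continuous_on_cube cont) simp
    then show thesis using that unfolding bounded_pos by auto
  qed
  \<comment> \<open>By compactness \<open>q\<close> is the maximum of \<open>T\<close> away from the
    ball of radius \<rho>; if the ball covers the cube, any value in \<open>[0, 1)\<close> will do
    and 0 is chosen.\<close>
  obtain q where q: "0 \<le> q" "q < 1" "\<And>x. x \<in> cbox 0 1 \<Longrightarrow> \<rho> \<le> dist x a \<Longrightarrow> T x \<le> q"
  proof (cases "cbox 0 1 - ball a \<rho> = {}")
    case True
    then show thesis using that [of 0] by (force simp: dist_commute)
  next
    case False
    have "compact (cbox 0 1 - ball a \<rho>)" by (intro compact_diff) auto
    then obtain y where y: "y \<in> cbox 0 1 - ball a \<rho>" "\<forall>x\<in>cbox 0 1 - ball a \<rho>. T x \<le> T y"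
      using continuous_attains_sup [OF _ False contT] by blast
    then have "y \<noteq> a" using \<rho>(1) by auto
    then show thesis using that [of "T y"] T0 T1 y by (auto simp: dist_commute)
  qed
  define r where "r = (1 + q) / 2"
  have r: "q < r" "0 < r" "r < 1" using q by (auto simp: r_def)
  have "open (box 0 1 \<inter> ball a \<rho> \<inter> T -` {r<..})"
    by (intro open_Int open_box open_ball open_vimage open_greaterThan contT)
  then obtain c d where cd: "\<forall>i\<in>Basis. c \<bullet> i < d \<bullet> i" "cbox c d \<subseteq> box 0 1 \<inter> ball a \<rho> \<inter> T -` {r<..}"
    by (rule open_contains_cbox [of _ a]) (use a \<rho>(1) r Ta in auto)
  define v where "v = measure lborel (cbox c d)"
  have v: "v > 0" using cd(1) unfolding v_def by (simp add: content_pos_lt_eq)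
  \<comment> \<open>The integral of \<open>h * T ^ N\<close> is zero. Adding
    \<open>M * q ^ N\<close> makes the integrand nonnegative on the whole cube, so its integral is
    at least that over the small box \<open>cbox c d\<close>, where \<open>T > r\<close> and
    \<open>h > h a / 2\<close>.\<close>
  have bound: "v * (h a / 2 * r ^ N) \<le> M * q ^ N" for N
  proof -
    let ?u = "\<lambda>x. h x * T x ^ N + M * q ^ N"
    have cu: "continuous_on UNIV ?u" by (intro continuous_intros cont contT)
    have low: "h a / 2 * r ^ N \<le> ?u x" if "x \<in> cbox c d" for x
    proof -
      have "h a / 2 \<le> h x" "r \<le> T x"
        using that cd(2) \<rho>(2) [of x] by (auto simp: dist_commute less_imp_le)
      then have "h a / 2 * r ^ N \<le> h x * T x ^ N"
        using pos r by (intro mult_mono power_mono) auto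
      moreover have "0 \<le> M * q ^ N" using M(1) q(1) by simp
      ultimately show ?thesis by simp
    qed
    have nonneg: "0 \<le> ?u x" if x: "x \<in> cbox 0 1" for x
    proof (cases "dist x a < \<rho>")
      case True
      then have "0 \<le> h x" using \<rho>(2) [of x] pos by simp
      then show ?thesis using T0 M(1) q(1) by simp
    next
      case False
      then have "\<bar>h x * T x ^ N\<bar> \<le> M * q ^ N"
        unfolding abs_mult using M x q(1,3) T0 by (auto intro!: mult_mono power_mono)
      then show ?thesis by linarith
    qed
    have "v * (h a / 2 * r ^ N) = integral (cbox c d) (\<lambda>x. h a / 2 * r ^ N)"
      by (simp add: v_def)
    also have "\<dots> \<le> integral (cbox c d) ?u"
      by (rule integral_le) (use low integrable_on_cube [OF cu] in auto)
    also have "\<dots> \<le> integral (cbox 0 1) ?u"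
      by (rule integral_subset_le)
         (use cd(2) box_subset_cbox [of 0 "1::real^'m"] nonneg integrable_on_cube [OF cu] in auto)
    also have "\<dots> = integral (cbox 0 1) (\<lambda>x. h x * T x ^ N) + integral (cbox 0 (1::real^'m)) (\<lambda>x. M * q ^ N)"
      by (intro integral_add integrable_on_cube continuous_intros cont contT)
    also have "\<dots> = M * q ^ N"
      using orthogonal_bump_power [of a N] by (simp add: T_def)
    finally show ?thesis .
  qed
  \<comment> \<open>Since \<open>q < r\<close>, division by \<open>r ^ N\<close> forces the fixed
    positive number \<open>v * (h a / 2)\<close> below a null sequence.\<close>
  have "(\<lambda>N. M * (q / r) ^ N) \<longlonglongrightarrow> M * 0"
    by (intro tendsto_intros LIMSEQ_power_zero) (use q r in auto)
  moreover have "v * (h a / 2) \<le> M * (q / r) ^ N" for N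
    using bound [of N] r by (simp add: power_divide field_simps)
  ultimately have "v * (h a / 2) \<le> M * 0"
    by (intro LIMSEQ_le_const) auto
  with v pos show False by (simp add: mult_le_0_iff)
qed

end

text \<open>Both \<open>h\<close> and \<open>- h\<close> are nonpositive in the open cube by
  concentration of the bumps. Continuity extends the zero to the closed cube, periodicity to the
  whole space.\<close>

lemma fourier_uniqueness_real:
  fixes h :: "real^'m \<Rightarrow> real"
  assumes cont: "continuous_on UNIV h" and per: "periodic h"
    and orth: "\<And>\<xi>. \<xi> \<in> freqs \<Longrightarrow>
      integral (cbox 0 1) (\<lambda>x. complex_of_real (h x) * wave \<xi> x) = 0"
  shows "h x = 0"
proof -
  have "h y = 0" if "y \<in> box 0 1" for y
  proof -
    have "- h y \<le> 0"
      by (rule orthogonal_imp_nonpos [of "\<lambda>x. - h x", OF _ _ that])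
         (use orth in \<open>auto intro!: continuous_intros cont\<close>)
    moreover have "h y \<le> 0" by (rule orthogonal_imp_nonpos [OF cont orth that])
    ultimately show ?thesis by simp
  qed
  moreover have "closure (box 0 (1 :: real^'m)) = cbox 0 1"
    by (rule closure_box) (simp add: interval_ne_empty_cart)
  ultimately have "h y = 0" if "y \<in> cbox 0 1" for y
    using continuous_constant_on_closure [of "box 0 1" h 0 y] that cont
    by (metis continuous_on_cube)
  moreover obtain y where "y \<in> torus" "h y = h x" using periodic_reduce [OF per] by metis
  ultimately show ?thesis
    by (auto simp: torus_def mem_box_cart less_imp_le)
qed

lemma integral_cnj_wave:
  fixes h :: "real^'m \<Rightarrow> complex"
  shows "integral (cbox 0 1) (\<lambda>x. cnj (h x) * wave \<xi> x) = cnj (integral (cbox 0 1) (\<lambda>x. h x * wave (- \<xi>) x))"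
  by (simp add: integral_cnj cnj_wave)

text \<open>The frequencies are symmetric under negation, so the conjugate of \<open>h\<close>
  satisfies the same orthogonality, and therefore so do the real and imaginary parts.\<close>

lemma fourier_uniqueness:
  fixes h :: "real^'m \<Rightarrow> complex"
  assumes cont: "continuous_on UNIV h" and per: "periodic h"
    and orth: "\<And>\<xi>. \<xi> \<in> freqs \<Longrightarrow> integral (cbox 0 1) (\<lambda>x. h x * wave \<xi> x) = 0"
  shows "h x = 0"
proof -
  have c: "continuous_on UNIV (\<lambda>x. k * (h x * wave \<xi> x))"
    "continuous_on UNIV (\<lambda>x. k * (cnj (h x) * wave \<xi> x))" for \<xi> k
    by (intro continuous_intros cont)+
  have orth': "integral (cbox 0 1) (\<lambda>x. cnj (h x) * wave \<xi> x) = 0" if "\<xi> \<in> freqs" for \<xi>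
    using orth [OF freqs_uminus [OF that]] by (simp add: integral_cnj_wave)
  have re: "complex_of_real (Re z) * w = 1/2 * (z * w) + 1/2 * (cnj z * w)" for z w
    by (simp add: complex_eq_iff field_simps)
  have im: "complex_of_real (Im z) * w = - \<i>/2 * (z * w) + \<i>/2 * (cnj z * w)" for z w
    by (simp add: complex_eq_iff field_simps)
  have comb: "integral (cbox 0 1) (\<lambda>x. k * (h x * wave \<xi> x) + m * (cnj (h x) * wave \<xi> x)) = 0"
    if "\<xi> \<in> freqs" for k m \<xi>
    by (subst integral_add) (use that in \<open>simp_all add: orth orth' integrable_on_cube c\<close>)
  have "Re (h x) = 0"
    by (rule fourier_uniqueness_real)
       (use per in \<open>auto simp: periodic_def intro!: continuous_intros cont\<close>, simp only: re comb)
  moreover have "Im (h x) = 0"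
    by (rule fourier_uniqueness_real)
       (use per in \<open>auto simp: periodic_def intro!: continuous_intros cont\<close>, simp only: im comb)
  ultimately show ?thesis by (simp add: complex_eq_iff)
qed


subsection \<open>Absolutely convergent trigonometric series and Fourier inversion\<close>

definition trig_series :: "(real^'m \<Rightarrow> complex) \<Rightarrow> real^'m \<Rightarrow> complex" where
  "trig_series a x = (\<Sum>\<^sub>\<infinity>\<xi>\<in>freqs. a \<xi> * wave \<xi> x)"

lemma continuous_on_trig_series:
  assumes "(\<lambda>\<xi>. norm (a \<xi>)) summable_on freqs"
  shows "continuous_on S (trig_series a)"
proof (rule uniform_limit_theorem)
  show "uniform_limit S (\<lambda>F x. \<Sum>\<xi>\<in>F. a \<xi> * wave \<xi> x) (trig_series a) (finite_subsets_at_top freqs)"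
    unfolding trig_series_def
    by (rule Weierstrass_m_test_general [where M = "\<lambda>\<xi>. norm (a \<xi>)"])
       (use assms in \<open>auto simp: norm_mult\<close>)
qed (auto intro!: always_eventually continuous_intros)

lemma periodic_trig_series: "periodic (trig_series a)"
  unfolding periodic_def trig_series_def
  by (intro allI infsum_cong) (use periodic_wave in \<open>auto simp: periodic_def\<close>)

lemma trig_series_cong:
  "(\<And>\<xi>. \<xi> \<in> freqs \<Longrightarrow> a \<xi> = b \<xi>) \<Longrightarrow> trig_series a x = trig_series b x"
  unfolding trig_series_def by (rule infsum_cong) simp

text \<open>Exchange of integral and series: \<open>u\<close> is bounded on the cube, so the
  Weierstrass test gives uniform convergence. The factor \<open>c\<close> is there for the dilations
  by \<open>l\<close>.\<close>

lemma has_sum_integral_trig_series: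
  fixes a :: "real^'m \<Rightarrow> complex" and c :: real
  assumes a: "(\<lambda>\<xi>. norm (a \<xi>)) summable_on freqs" and u: "continuous_on UNIV u"
  shows "((\<lambda>\<xi>. a \<xi> * integral (cbox 0 1) (\<lambda>x. u x * wave \<xi> (c *\<^sub>R x))) has_sum
    integral (cbox 0 1) (\<lambda>x. u x * trig_series a (c *\<^sub>R x))) freqs"
proof -
  let ?f = "\<lambda>\<xi> x. u x * (a \<xi> * wave \<xi> (c *\<^sub>R x))"
  have contf: "continuous_on UNIV (?f \<xi>)" for \<xi>
    by (intro continuous_intros u)
  have "bounded (u ` cbox 0 1)"
    by (intro compact_imp_bounded compact_continuous_image continuous_on_cube u) simp
  then obtain B where B: "\<And>x. x \<in> cbox 0 1 \<Longrightarrow> norm (u x) \<le> B"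
    unfolding bounded_pos by auto
  have "uniform_limit (cbox 0 1) (\<lambda>F x. \<Sum>\<xi>\<in>F. ?f \<xi> x) (\<lambda>x. \<Sum>\<^sub>\<infinity>\<xi>\<in>freqs. ?f \<xi> x)
      (finite_subsets_at_top freqs)"
    by (rule Weierstrass_m_test_general [where M = "\<lambda>\<xi>. B * norm (a \<xi>)"])
       (use a B in \<open>auto simp: norm_mult intro!: mult_right_mono summable_on_cmult_right\<close>)
  then have ul: "uniform_limit (cbox 0 1) (\<lambda>F x. \<Sum>\<xi>\<in>F. ?f \<xi> x) (\<lambda>x. u x * trig_series a (c *\<^sub>R x))
      (finite_subsets_at_top freqs)"
    by (simp add: trig_series_def infsum_cmult_right')
  obtain I J where IJ: "\<And>F. ((\<lambda>x. \<Sum>\<xi>\<in>F. ?f \<xi> x) has_integral I F) (cbox 0 1)"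
      "((\<lambda>x. u x * trig_series a (c *\<^sub>R x)) has_integral J) (cbox 0 1)"
      "(I \<longlongrightarrow> J) (finite_subsets_at_top freqs)"
    by (rule uniform_limit_integral_cbox [OF ul])
       (auto intro!: continuous_on_sum continuous_on_cube contf)
  have "I F = (\<Sum>\<xi>\<in>F. a \<xi> * integral (cbox 0 1) (\<lambda>x. u x * wave \<xi> (c *\<^sub>R x)))" if "finite F" for F
  proof -
    have "I F = integral (cbox 0 1) (\<lambda>x. \<Sum>\<xi>\<in>F. ?f \<xi> x)"
      by (rule integral_unique [OF IJ(1), symmetric])
    also have "\<dots> = (\<Sum>\<xi>\<in>F. integral (cbox 0 1) (?f \<xi>))"
      by (intro integral_sum that integrable_on_cube contf)
    finally show ?thesis
      by (simp add: mult.left_commute [of "u _"])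
  qed
  then have "eventually (\<lambda>F. I F = (\<Sum>\<xi>\<in>F. a \<xi> * integral (cbox 0 1) (\<lambda>x. u x * wave \<xi> (c *\<^sub>R x))))
      (finite_subsets_at_top freqs)"
    by (intro eventually_finite_subsets_at_top_weakI) auto
  from tendsto_cong [OF this] IJ(2,3) show ?thesis
    unfolding has_sum_def by (simp add: integral_unique)
qed

text \<open>An absolutely convergent series determines its coefficients: integrating termwise,
  orthogonality leaves only the term at \<xi>.\<close>

lemma integral_trig_series_wave:
  assumes "(\<lambda>\<xi>. norm (a \<xi>)) summable_on freqs" "\<xi> \<in> freqs"
  shows "integral (cbox 0 1) (\<lambda>x. trig_series a x * wave (- \<xi>) x) = a \<xi>"
proof -
  have "((\<lambda>\<eta>. a \<eta> * integral (cbox 0 1) (wave (\<eta> + - \<xi>))) has_sum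
      integral (cbox 0 1) (\<lambda>x. wave (- \<xi>) x * trig_series a x)) freqs"
  proof -
    have "wave (\<eta> + - \<xi>) = (\<lambda>x. wave (- \<xi>) x * wave \<eta> x)" for \<eta>
      by (simp only: wave_add [of \<eta> "- \<xi>"] mult.commute fun_eq_iff) simp
    then show ?thesis
      using has_sum_integral_trig_series [OF assms(1), of "wave (- \<xi>)" 1]
      by (simp add: continuous_on_wave)
  qed
  moreover have "((\<lambda>\<eta>. a \<eta> * integral (cbox 0 1) (wave (\<eta> + - \<xi>))) has_sum a \<xi>) freqs"
    by (rule has_sum_finite_neutralI [where B = "{\<xi>}"])
       (use assms(2) in \<open>auto simp: integral_wave freqs_add freqs_uminus add_eq_0_iff2 simp del: add_uminus_conv_diff\<close>)
  ultimately show ?thesis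
    using has_sum_unique by (simp add: mult.commute) blast
qed

lemma fourier_coeff_eq_integral:
  assumes "continuous_on UNIV h"
  shows "fourier_coeff h \<xi> = integral (cbox 0 1) (\<lambda>x. complex_of_real (h x) * wave (- \<xi>) x)"
proof -
  have "continuous_on UNIV (\<lambda>x. complex_of_real (h x) * wave (- \<xi>) x)"
    by (intro continuous_intros assms)
  from torus_integral_eq_integral [OF this] show ?thesis
    by (simp add: fourier_coeff_def wave_def)
qed

lemma fourier_coeff_0:
  assumes "continuous_on UNIV h"
  shows "fourier_coeff h 0 = complex_of_real (torus_integral h)"
proof -
  have "integral (cbox 0 1) (complex_of_real \<circ> h) = complex_of_real (integral (cbox 0 1) h)"
    by (rule integral_linear [OF integrable_on_cube [OF assms] bounded_linear_of_real])
  then show ?thesis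
    by (simp add: fourier_coeff_eq_integral [OF assms] torus_integral_eq_integral [OF assms] o_def)
qed

lemma fourier_coeff_diff:
  assumes "continuous_on UNIV u" "continuous_on UNIV v"
  shows "fourier_coeff (\<lambda>x. u x - v x) \<xi> = fourier_coeff u \<xi> - fourier_coeff v \<xi>"
proof -
  have "continuous_on UNIV (\<lambda>x. u x - v x)" by (intro continuous_intros assms)
  moreover have "integral (cbox 0 1) (\<lambda>x. complex_of_real (u x) * wave (- \<xi>) x - complex_of_real (v x) * wave (- \<xi>) x) =
      integral (cbox 0 1) (\<lambda>x. complex_of_real (u x) * wave (- \<xi>) x) -
      integral (cbox 0 1) (\<lambda>x. complex_of_real (v x) * wave (- \<xi>) x)"
    by (intro integral_diff integrable_on_cube continuous_intros assms)
  ultimately show ?thesis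
    by (simp add: fourier_coeff_eq_integral assms left_diff_distrib)
qed

lemma norm_fourier_coeff_le:
  assumes "continuous_on UNIV h"
  shows "norm (fourier_coeff h \<xi>) \<le> integral (cbox 0 1) (\<lambda>x. \<bar>h x\<bar>)"
  unfolding fourier_coeff_eq_integral [OF assms]
  by (intro integral_norm_bound_integral integrable_on_cube continuous_intros assms)
     (simp add: norm_mult)

text \<open>Formulated for integrals against waves, because it is applied both to Fourier
  coefficients and to the dilated frequencies \<open>l *\<^sub>R \<xi>\<close>.\<close>

lemma integral_partial_mult_wave:
  assumes u: "C_diff 1 u" "periodic u" and \<xi>: "\<xi> \<in> freqs"
  shows "integral (cbox 0 1) (\<lambda>x. complex_of_real (partial i u x) * wave \<xi> x) =
    - (\<i> * complex_of_real (\<xi> $ i)) * integral (cbox 0 1) (\<lambda>x. complex_of_real (u x) * wave \<xi> x)"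
proof -
  have "integral (cbox 0 1) (\<lambda>x. partial i u x *\<^sub>R wave \<xi> x) =
      - integral (cbox 0 1) (\<lambda>x. u x *\<^sub>R partial i (wave \<xi>) x)"
    by (rule integral_by_parts_cube [OF bounded_bilinear_scaleR u C_diff_1_wave periodic_wave [OF \<xi>]])
  also have "\<dots> = - integral (cbox 0 1) (\<lambda>x. \<i> * complex_of_real (\<xi> $ i) * (complex_of_real (u x) * wave \<xi> x))"
    by (simp add: partial_wave scaleR_conv_of_real mult_ac)
  finally show ?thesis by (simp add: scaleR_conv_of_real)
qed

section \<open>Decay of the Fourier coefficients of smooth functions and Fourier inversion\<close>

lemma smooth_imp_C_diff_1: "smooth h \<Longrightarrow> C_diff 1 h"
  unfolding smooth_def by blast

lemma smooth_imp_continuous: "smooth h \<Longrightarrow> continuous_on UNIV h"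
  unfolding smooth_def by (metis C_diff.simps(1))

lemma smooth_partial: "smooth h \<Longrightarrow> smooth (partial i h)"
  unfolding smooth_def by (metis C_diff.simps(2))

lemma C_diff_diff: "C_diff n u \<Longrightarrow> C_diff n v \<Longrightarrow> C_diff n (\<lambda>x. u x - v x)"
proof (induction n arbitrary: u v)
  case 0
  then show ?case by (auto intro: continuous_intros)
next
  case (Suc n)
  have "partial i (\<lambda>x. u x - v x) = (\<lambda>x. partial i u x - partial i v x)" for i
  proof
    fix x
    obtain D E where D: "(u has_derivative D) (at x)" and E: "(v has_derivative E) (at x)"
      using Suc.prems by (auto simp: differentiable_def) metis
    show "partial i (\<lambda>x. u x - v x) x = partial i u x - partial i v x"
      by (simp add: has_derivative_imp_partial [OF D] has_derivative_imp_partial [OF E]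
          has_derivative_imp_partial [OF has_derivative_diff [OF D E]])
  qed
  with Suc show ?case by (auto intro!: differentiable_diff)
qed

lemma smooth_diff: "smooth u \<Longrightarrow> smooth v \<Longrightarrow> smooth (\<lambda>x. u x - v x)"
  unfolding smooth_def by (blast intro: C_diff_diff)

lemma fourier_coeff_partial:
  assumes "smooth h" "periodic h" "\<xi> \<in> freqs"
  shows "fourier_coeff (partial i h) \<xi> = \<i> * complex_of_real (\<xi> $ i) * fourier_coeff h \<xi>"
  using integral_partial_mult_wave [OF smooth_imp_C_diff_1 [OF assms(1)] assms(2) freqs_uminus [OF assms(3)]]
  by (simp add: fourier_coeff_eq_integral smooth_imp_continuous smooth_partial assms)

text \<open>The witness is \<open>\<Prod>\<^bsub>i\<in>I\<^esub> (1 - \<partial>\<^sub>i\<^sup>2) h\<close>.\<close>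

lemma fourier_coeff_decay:
  assumes "smooth (h :: real^'m \<Rightarrow> real)" "periodic h" "finite I"
  shows "\<exists>k. smooth k \<and> periodic k \<and> (\<forall>\<xi>\<in>freqs.
    fourier_coeff k \<xi> = complex_of_real (\<Prod>i\<in>I. 1 + (\<xi> $ i)\<^sup>2) * fourier_coeff h \<xi>)"
  using assms(3)
proof induction
  case empty
  then show ?case using assms by auto
next
  case (insert i I)
  then obtain k where k: "smooth k" "periodic k"
    "\<And>\<xi>. \<xi> \<in> freqs \<Longrightarrow> fourier_coeff k \<xi> = complex_of_real (\<Prod>i\<in>I. 1 + (\<xi> $ i)\<^sup>2) * fourier_coeff h \<xi>"
    by blast
  let ?k = "\<lambda>x. k x - partial i (partial i k) x"
  have "fourier_coeff ?k \<xi> = complex_of_real (\<Prod>i\<in>insert i I. 1 + (\<xi> $ i)\<^sup>2) * fourier_coeff h \<xi>"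
    if "\<xi> \<in> freqs" for \<xi>
    using that insert.hyps k
    by (simp add: fourier_coeff_diff fourier_coeff_partial smooth_imp_continuous smooth_partial
        periodic_partial algebra_simps power2_eq_square)
  moreover have "smooth ?k" "periodic ?k"
    using k(1,2) periodic_partial [OF periodic_partial [OF k(2), of i], of i]
    by (auto intro!: smooth_diff smooth_partial simp: periodic_def)
  ultimately show ?case by blast
qed

text \<open>What matters is a bound independent of \<open>B\<close>. For n at least 1 the term at
  \<open>2 * pi * n\<close> is at most \<open>1/n - 1/(n+1)\<close>; the two telescoping tails
  contribute at most 2 and the term at zero contributes 1.\<close>

lemma sum_inverse_square_le:
  assumes "finite B" "\<And>b. b \<in> B \<Longrightarrow> \<exists>n::int. b = 2 * pi * of_int n"
  shows "(\<Sum>b\<in>B. 1 / (1 + b\<^sup>2)) \<le> 3"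
proof -
  let ?g = "\<lambda>n::int. 1 / (1 + (2 * pi * of_int n)\<^sup>2) :: real"
  have le: "(\<Sum>n\<in>{- int N..int N}. ?g n) \<le> 3 - 2 / (real N + 1)" for N
  proof (induction N)
    case (Suc N)
    have eq: "{- int (Suc N)..int (Suc N)} = insert (- int (Suc N)) (insert (int (Suc N)) {- int N..int N})"
      by auto
    have "(2 * pi * (real N + 1))\<^sup>2 \<ge> (2 * (real N + 1))\<^sup>2"
      using pi_gt3 by (intro power_mono mult_right_mono) auto
    then have "1 + (2 * pi * (real N + 1))\<^sup>2 \<ge> (real N + 1) * (real N + 2)"
      by (simp add: power2_eq_square algebra_simps) (use zero_le_square [of "real N"] in linarith)
    then have "1 / (1 + (2 * pi * (real N + 1))\<^sup>2) \<le> 1 / ((real N + 1) * (real N + 2))"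
      by (intro frac_le) auto
    also have "\<dots> = 1 / (real N + 1) - 1 / (real N + 2)"
      by (simp add: field_simps)
    finally have "?g (int (Suc N)) \<le> 1 / (real N + 1) - 1 / (real N + 2)"
      by (simp add: add.commute)
    moreover have "?g (- int (Suc N)) = ?g (int (Suc N))"
      by (simp add: power2_eq_square algebra_simps)
    ultimately show ?case
      using Suc unfolding eq by (simp add: add.commute)
  qed simp
  define n where "n b = (SOME n::int. b = 2 * pi * of_int n)" for b
  have n: "b = 2 * pi * of_int (n b)" if "b \<in> B" for b
    unfolding n_def using assms(2) [OF that] by (rule someI_ex)
  define N where "N = nat (\<Sum>b\<in>B. \<bar>n b\<bar>)"
  have "\<bar>n b\<bar> \<le> (\<Sum>b\<in>B. \<bar>n b\<bar>)" if "b \<in> B" for b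
    using that assms(1) by (intro member_le_sum) auto
  then have N: "n ` B \<subseteq> {- int N..int N}"
    by (fastforce simp: N_def)
  have "inj_on n B" using n by (metis inj_onI)
  have "(\<Sum>b\<in>B. 1 / (1 + b\<^sup>2)) = (\<Sum>b\<in>B. ?g (n b))"
    by (rule sum.cong) (use n in auto)
  also have "\<dots> = (\<Sum>m\<in>n ` B. ?g m)"
    by (simp add: sum.reindex [OF \<open>inj_on n B\<close>])
  also have "\<dots> \<le> (\<Sum>m\<in>{- int N..int N}. ?g m)"
    by (rule sum_mono2) (use N in auto)
  also have "\<dots> \<le> 3" using le [of N] by (smt (verit) divide_nonneg_nonneg of_nat_0_le_iff)
  finally show ?thesis .
qed

text \<open>A finite set of frequencies lies in the product of its coordinate projections. The sum
  over that product factors into one-dimensional sums, each at most 3.\<close>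

lemma summable_on_prod_inverse_square:
  "(\<lambda>\<xi> :: real^'m. \<Prod>i\<in>UNIV. 1 / (1 + (\<xi> $ i)\<^sup>2)) summable_on freqs"
proof (rule nonneg_bdd_above_summable_on)
  show "bdd_above (sum (\<lambda>\<xi> :: real^'m. \<Prod>i\<in>UNIV. 1 / (1 + (\<xi> $ i)\<^sup>2)) ` {F. F \<subseteq> freqs \<and> finite F})"
  proof (rule bdd_aboveI2)
    fix F :: "(real^'m) set" assume F: "F \<in> {F. F \<subseteq> freqs \<and> finite F}"
    define B where "B i = (\<lambda>\<xi>. \<xi> $ i) ` F" for i
    have finB: "finite (B i)" for i using F by (simp add: B_def)
    have "(\<Sum>\<xi>\<in>F. \<Prod>i\<in>UNIV. 1 / (1 + (\<xi> $ i)\<^sup>2)) =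
        (\<Sum>b\<in>vec_nth ` F. \<Prod>i\<in>UNIV. 1 / (1 + (b i)\<^sup>2))"
      by (subst sum.reindex) (auto simp: inj_on_def vec_nth_inject)
    also have "\<dots> \<le> (\<Sum>b\<in>PiE UNIV B. \<Prod>i\<in>UNIV. 1 / (1 + (b i)\<^sup>2))"
      by (rule sum_mono2) (auto simp: B_def finB [unfolded B_def] F intro!: finite_PiE prod_nonneg)
    also have "\<dots> = (\<Prod>i\<in>UNIV. \<Sum>b\<in>B i. 1 / (1 + b\<^sup>2))"
      by (rule prod_sum_PiE [symmetric]) (auto simp: finB)
    also have "\<dots> \<le> (\<Prod>i\<in>(UNIV :: 'm set). 3)"
      by (rule prod_mono, intro conjI sum_nonneg sum_inverse_square_le finB)
         (use F in \<open>auto simp: B_def freqs_def\<close>)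
    finally show "(\<Sum>\<xi>\<in>F. \<Prod>i\<in>UNIV. 1 / (1 + (\<xi> $ i)\<^sup>2)) \<le> (\<Prod>i\<in>(UNIV :: 'm set). 3)" .
  qed
qed (auto intro!: prod_nonneg)

text \<open>Bounded coefficients of the differentiated function \<open>k\<close> give decay of those
  of \<open>h\<close>. The weight is a product over the coordinates, so that summability reduces to
  dimension one.\<close>

lemma abs_summable_fourier_coeff:
  assumes "smooth (h :: real^'m \<Rightarrow> real)" "periodic h"
  shows "(\<lambda>\<xi>. norm (fourier_coeff h \<xi>)) summable_on freqs"
proof -
  obtain k where k: "smooth k" "\<And>\<xi>. \<xi> \<in> freqs \<Longrightarrow>
      fourier_coeff k \<xi> = complex_of_real (\<Prod>i\<in>UNIV. 1 + (\<xi> $ i)\<^sup>2) * fourier_coeff h \<xi>"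
    using fourier_coeff_decay [OF assms, of UNIV] by auto
  let ?M = "integral (cbox 0 1) (\<lambda>x. \<bar>k x\<bar>)"
  have "norm (fourier_coeff h \<xi>) \<le> ?M * (\<Prod>i\<in>UNIV. 1 / (1 + (\<xi> $ i)\<^sup>2))" if "\<xi> \<in> freqs" for \<xi>
  proof -
    have pos: "(\<Prod>i\<in>UNIV. 1 + (\<xi> $ i)\<^sup>2) > 0"
      by (intro prod_pos) (auto intro: add_pos_nonneg)
    have "(\<Prod>i\<in>UNIV. 1 + (\<xi> $ i)\<^sup>2) * norm (fourier_coeff h \<xi>) = norm (fourier_coeff k \<xi>)"
      using pos by (simp add: k(2) [OF that] norm_mult del: of_real_prod)
    also have "\<dots> \<le> ?M" by (rule norm_fourier_coeff_le [OF smooth_imp_continuous [OF k(1)]])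
    finally show ?thesis using pos by (simp add: prod_dividef field_simps)
  qed
  then show ?thesis
    by (rule Infinite_Sum.abs_summable_on_comparison_test'
        [OF summable_on_cmult_right [OF summable_on_prod_inverse_square]])
qed

text \<open>The difference of the function and its series is continuous, periodic and has vanishing
  Fourier coefficients, so uniqueness applies.\<close>

theorem fourier_inversion:
  assumes "smooth (h :: real^'m \<Rightarrow> real)" "periodic h"
  shows "trig_series (fourier_coeff h) x = complex_of_real (h x)"
proof -
  let ?c = "fourier_coeff h"
  note summable = abs_summable_fourier_coeff [OF assms]
  note cont = continuous_on_trig_series [OF summable] smooth_imp_continuous [OF assms(1)]
  have "complex_of_real (h x) - trig_series ?c x = 0"
  proof (rule fourier_uniqueness)
    fix \<xi> :: "real^'m" assume "\<xi> \<in> freqs"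
    then have \<xi>: "- \<xi> \<in> freqs" by (rule freqs_uminus)
    have "integral (cbox 0 1) (\<lambda>x. complex_of_real (h x) * wave \<xi> x - trig_series ?c x * wave \<xi> x) =
        integral (cbox 0 1) (\<lambda>x. complex_of_real (h x) * wave \<xi> x) -
        integral (cbox 0 1) (\<lambda>x. trig_series ?c x * wave \<xi> x)"
      by (intro integral_diff integrable_on_cube continuous_intros cont)
    also have "\<dots> = 0"
      using integral_trig_series_wave [OF summable \<xi>] fourier_coeff_eq_integral [OF cont(2), of "- \<xi>"]
      by simp
    finally show "integral (cbox 0 1) (\<lambda>x. (complex_of_real (h x) - trig_series ?c x) * wave \<xi> x) = 0"
      by (simp add: left_diff_distrib)
  qed (use assms(2) periodic_trig_series [of ?c] in
      \<open>auto intro!: continuous_intros cont simp: periodic_def\<close>)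
  then show ?thesis by simp
qed


subsection \<open>Contraction of basis multivectors\<close>

lemma inversions_singleton_right: "inversions B {j} = card {b\<in>B. j < b}"
proof -
  have "{(a, b). a \<in> B \<and> b \<in> {j} \<and> b < a} = (\<lambda>b. (b, j)) ` {b\<in>B. j < b}" by auto
  then show ?thesis by (simp add: inversions_def card_image inj_on_def)
qed

lemma inversions_singleton_left: "inversions {i} B = card {b\<in>B. b < i}"
proof -
  have "{(a, b). a \<in> {i} \<and> b \<in> B \<and> b < a} = Pair i ` {b\<in>B. b < i}" by auto
  then show ?thesis by (simp add: inversions_def card_image inj_on_def)
qed

text \<open>Every element of \<open>B\<close> lies on exactly one side of \<open>j\<close>. This
  adds up the signs of inserting \<open>j\<close> behind \<open>B\<close> and removing it from the
  front.\<close>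

lemma inversions_singleton_add:
  assumes "finite B" "j \<notin> B"
  shows "inversions {j} B + inversions B {j} = card B"
proof -
  have "card B = card ({b\<in>B. b < j} \<union> {b\<in>B. j < b})"
    by (rule arg_cong [where f = card]) (use assms(2) in \<open>auto, metis linorder_cases\<close>)
  also have "\<dots> = card {b\<in>B. b < j} + card {b\<in>B. j < b}"
    by (rule card_Un_disjoint) (use assms(1) in auto)
  finally show ?thesis
    by (simp add: inversions_singleton_left inversions_singleton_right)
qed

text \<open>In the sum over splittings of \<open>C\<close> only \<open>A\<close> with complement
  \<open>B\<close> can contribute, and this occurs exactly for
  \<open>C = A \<union> B\<close>.\<close>

lemma wedge_axis:
  fixes A B :: "'d::{finite,linorder} set"
  assumes "A \<inter> B = {}"
  shows "axis A 1 \<and>\<^sub>e axis B 1 = (- 1) ^ inversions A B *\<^sub>R axis (A \<union> B) 1"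
proof (rule vec_eq_iff [THEN iffD2, rule_format])
  fix C :: "'d set"
  have "(axis A 1 \<and>\<^sub>e axis B 1) $ C =
      (\<Sum>A'\<in>Pow C. if A' = A then (- 1) ^ inversions A (C - A) * axis B 1 $ (C - A) else 0)"
    unfolding wedge_def vec_lambda_beta by (rule sum.cong) (auto simp: axis_def)
  also have "\<dots> = (if A \<subseteq> C then (- 1) ^ inversions A (C - A) * axis B 1 $ (C - A) else 0)"
    by simp
  also have "\<dots> = ((- 1) ^ inversions A B *\<^sub>R axis (A \<union> B) 1) $ C"
  proof (cases "C = A \<union> B")
    case True
    then have "C - A = B" using assms by auto
    with True show ?thesis by (simp add: axis_def)
  next
    case False
    then have "A \<subseteq> C \<Longrightarrow> C - A \<noteq> B" by auto
    with False show ?thesis by (auto simp: axis_def)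
  qed
  finally show "(axis A 1 \<and>\<^sub>e axis B 1) $ C = ((- 1) ^ inversions A B *\<^sub>R axis (A \<union> B) 1) $ C" .
qed

text \<open>The head of a strictly sorted list lies below all later entries, so no wedge in the fold
  produces an inversion and every sign is 1.\<close>

lemma e_multi_sorted:
  "sorted_wrt (<) \<beta> \<Longrightarrow> e_multi \<beta> = axis (set \<beta>) 1"
proof (induction \<beta>)
  case (Cons i \<beta>)
  then have *: "{b \<in> set \<beta>. b < i} = {}" "{i} \<inter> set \<beta> = {}" by auto
  have "e_multi (i # \<beta>) = axis {i} 1 \<and>\<^sub>e axis (set \<beta>) 1"
    using Cons by (simp add: e_multi_def e_vec_def)
  then show ?case
    unfolding wedge_axis [OF *(2)] inversions_singleton_left *(1) by simp
qed (simp add: e_multi_def)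

lemma contract_scaleR: "contract (c *\<^sub>R \<tau>) i = c *\<^sub>R contract \<tau> i"
  by (rule contract_unique [symmetric]) (simp add: inner_contract)

text \<open>By adjointness it is enough to read off the component of
  \<open>dx i \<and>\<^sub>e \<omega>\<close> at \<open>D\<close>, to which only the splitting with
  left part \<open>{i}\<close> contributes.\<close>

lemma contract_axis:
  fixes D :: "'d::{finite,linorder} set"
  shows "contract (axis D 1) i =
    (if i \<in> D then (- 1) ^ inversions {i} (D - {i}) *\<^sub>R axis (D - {i}) 1 else 0)"
proof (rule contract_unique [symmetric])
  fix \<omega> :: "'d multivector"
  have "(dx i \<and>\<^sub>e \<omega>) $ D =
      (\<Sum>A\<in>Pow D. if A = {i} then (- 1) ^ inversions {i} (D - {i}) * \<omega> $ (D - {i}) else 0)"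
    unfolding wedge_def dx_def vec_lambda_beta by (rule sum.cong) (auto simp: axis_def)
  then show "\<omega> \<bullet> (if i \<in> D then (- 1) ^ inversions {i} (D - {i}) *\<^sub>R axis (D - {i}) 1 else 0) =
      (dx i \<and>\<^sub>e \<omega>) \<bullet> axis D 1"
    by (simp add: inner_axis)
qed

text \<open>For \<open>i \<noteq> j\<close> the index \<open>i\<close> is missing from
  \<open>insert j B\<close>. For \<open>i = j\<close> the vector is wedged on the right but
  contracted from the left, and moving it across \<open>B\<close> costs the sign.\<close>

lemma contract_wedge_e_vec:
  fixes B :: "'d::{finite,linorder} set"
  assumes "i \<notin> B" "j \<notin> B"
  shows "contract (axis B 1 \<and>\<^sub>e e_vec j) i = (if i = j then (- 1) ^ card B *\<^sub>R axis B 1 else 0)"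
proof -
  have "B \<inter> {j} = {}" using assms by auto
  then have "contract (axis B 1 \<and>\<^sub>e e_vec j) i =
      (- 1) ^ inversions B {j} *\<^sub>R contract (axis (insert j B) 1) i"
    by (simp add: e_vec_def wedge_axis contract_scaleR)
  then show ?thesis
    using assms inversions_singleton_add [of B j]
    by (auto simp: contract_axis simp flip: power_add) (simp add: add.commute)
qed


subsection \<open>The inverse divergence\<close>

text \<open>The coefficients are guessed rather than computed by integrating over fibres: those of
  \<open>h\<close>, transported along the embedding \<open>E\<close> of frequencies and zero
  elsewhere, have a series summing to \<open>u\<close>. Since a series determines its coefficients,
  they are the coefficients of \<open>u\<close>, and all four claims can be read off.\<close>

lemma fourier_series_pullback:
  fixes h :: "real^'n \<Rightarrow> real" and s :: "'n \<Rightarrow> 'd::finite"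
  assumes h: "smooth h" "periodic h" and s: "inj s"
  defines "u \<equiv> \<lambda>x :: real^'d. h (\<chi> j. x $ s j)"
  shows summable_fourier_coeff_pullback: "(\<lambda>\<xi>. norm (fourier_coeff u \<xi>)) summable_on freqs"
    and trig_series_pullback: "trig_series (fourier_coeff u) x = complex_of_real (u x)"
    and fourier_coeff_pullback_0: "fourier_coeff u 0 = fourier_coeff h 0"
    and fourier_coeff_pullback_eq_0:
      "\<lbrakk>\<xi> \<in> freqs; i \<notin> range s; \<xi> $ i \<noteq> 0\<rbrakk> \<Longrightarrow> fourier_coeff u \<xi> = 0"
proof -
  define L where "L x = (\<chi> j. x $ s j)" for x :: "real^'d"
  \<comment> \<open>Extension by zero, the adjoint of the coordinate selection \<open>L\<close>;
    thus a wave at \<open>\<eta>\<close> composed with \<open>L\<close> is the wave at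
    \<open>E \<eta>\<close>.\<close>
  define E where "E \<eta> = (\<chi> i. if i \<in> range s then \<eta> $ inv s i else 0)" for \<eta> :: "real^'n"
  have LE: "L (E \<eta>) = \<eta>" for \<eta>
    using s by (simp add: L_def E_def vec_eq_iff)
  have inner_E: "E \<eta> \<bullet> x = \<eta> \<bullet> L x" for \<eta> x
  proof -
    have "E \<eta> \<bullet> x = (\<Sum>i\<in>UNIV. if i \<in> range s then \<eta> $ inv s i * x $ i else 0)"
      by (simp add: inner_vec_def E_def if_distrib [where f = "\<lambda>a. a * _"] cong: if_cong)
    also have "\<dots> = (\<Sum>i\<in>range s. \<eta> $ inv s i * x $ i)"
      by (simp add: sum.If_cases)
    also have "\<dots> = \<eta> \<bullet> L x"
      using s by (simp add: sum.reindex inner_vec_def L_def)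
    finally show ?thesis .
  qed
  have E_freqs: "E ` freqs \<subseteq> freqs"
    by (auto simp: E_def freqs_def intro: exI [of _ 0])
  have inj: "inj_on E freqs" by (metis LE inj_onI)
  have wave_E: "wave (E \<eta>) x = wave \<eta> (L x)" for \<eta> x
    by (simp add: wave_def inner_E)
  define c where "c \<xi> = (if \<xi> \<in> E ` freqs then fourier_coeff h (L \<xi>) else 0)" for \<xi>
  have "(\<lambda>\<xi>. norm (c \<xi>)) summable_on freqs \<longleftrightarrow>
      (\<lambda>\<xi>. norm (fourier_coeff h (L \<xi>))) summable_on E ` freqs"
    by (rule summable_on_cong_neutral) (use E_freqs in \<open>auto simp: c_def\<close>)
  also have "\<dots> \<longleftrightarrow> (\<lambda>\<eta>. norm (fourier_coeff h \<eta>)) summable_on freqs"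
    by (subst summable_on_reindex [OF inj]) (simp add: o_def LE)
  finally have summable_c: "(\<lambda>\<xi>. norm (c \<xi>)) summable_on freqs"
    using abs_summable_fourier_coeff [OF h] by simp
  have series_c: "trig_series c x = complex_of_real (u x)" for x
  proof -
    have "trig_series c x = (\<Sum>\<^sub>\<infinity>\<xi>\<in>E ` freqs. fourier_coeff h (L \<xi>) * wave \<xi> x)"
      unfolding trig_series_def
      by (rule infsum_cong_neutral) (use E_freqs in \<open>auto simp: c_def\<close>)
    also have "\<dots> = trig_series (fourier_coeff h) (L x)"
      unfolding trig_series_def by (subst infsum_reindex [OF inj]) (simp add: o_def LE wave_E)
    also have "\<dots> = complex_of_real (u x)"
      by (simp add: fourier_inversion [OF h] u_def L_def)
    finally show ?thesis .
  qed
  have cont_u: "continuous_on UNIV u"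
    unfolding u_def
    by (rule continuous_on_compose2 [OF smooth_imp_continuous [OF h(1)]])
       (auto intro!: continuous_intros)
  have coeff: "fourier_coeff u \<xi> = c \<xi>" if "\<xi> \<in> freqs" for \<xi>
    using integral_trig_series_wave [OF summable_c that]
    by (simp add: fourier_coeff_eq_integral [OF cont_u] series_c)
  show "(\<lambda>\<xi>. norm (fourier_coeff u \<xi>)) summable_on freqs"
    using summable_c by (simp add: coeff cong: summable_on_cong)
  show "trig_series (fourier_coeff u) x = complex_of_real (u x)"
    unfolding series_c [symmetric] by (rule trig_series_cong) (rule coeff)
  have "E 0 = 0" "L 0 = 0" by (simp_all add: E_def L_def vec_eq_iff)
  then have "0 \<in> E ` freqs" by (metis image_eqI zero_in_freqs)
  then show "fourier_coeff u 0 = fourier_coeff h 0"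
    by (simp add: coeff c_def \<open>L 0 = 0\<close>)
  show "fourier_coeff u \<xi> = 0" if "\<xi> \<in> freqs" "i \<notin> range s" "\<xi> $ i \<noteq> 0"
    using that by (auto simp: coeff c_def E_def)
qed

section \<open>The weak gradient and the trace of the inverse divergence\<close>

lemma trig_series_sum:
  assumes "finite J" "\<And>j. j \<in> J \<Longrightarrow> (\<lambda>\<xi>. norm (a j \<xi>)) summable_on freqs"
  shows "(\<Sum>j\<in>J. trig_series (a j) x) = trig_series (\<lambda>\<xi>. \<Sum>j\<in>J. a j \<xi>) x"
proof -
  have "((\<lambda>\<xi>. \<Sum>j\<in>J. a j \<xi> * wave \<xi> x) has_sum (\<Sum>j\<in>J. trig_series (a j) x)) freqs"
    using assms
  proof (induction J)
    case (insert k J)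
    have "(\<lambda>\<xi>. a k \<xi> * wave \<xi> x) summable_on freqs"
      by (rule abs_summable_summable) (use insert.prems [of k] in \<open>simp add: norm_mult\<close>)
    then have "((\<lambda>\<xi>. a k \<xi> * wave \<xi> x) has_sum trig_series (a k) x) freqs"
      unfolding trig_series_def by (rule has_sum_infsum)
    then show ?case
      using insert by (simp add: has_sum_add)
  qed simp
  then show ?thesis
    by (simp add: trig_series_def sum_distrib_right infsumI)
qed

text \<open>A nonzero component of a frequency has absolute value at least 1, so it is at most its
  square. Hence the multiplier of \<open>div_inv\<close> is bounded by 1 on
  \<open>freqs\<close>.\<close>

lemma freqs_component_le: "\<xi> \<in> freqs \<Longrightarrow> \<bar>\<xi> $ j\<bar> \<le> (norm \<xi>)\<^sup>2"
proof -
  assume "\<xi> \<in> freqs"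
  then obtain n :: int where n: "\<xi> $ j = 2 * pi * of_int n" by (auto simp: freqs_def)
  have "\<bar>\<xi> $ j\<bar> \<le> \<bar>\<xi> $ j\<bar>\<^sup>2"
  proof (cases "n = 0")
    case False
    then have "1 \<le> \<bar>of_int n :: real\<bar>" by linarith
    then have "1 * 1 \<le> (2 * pi) * \<bar>of_int n :: real\<bar>"
      using pi_gt3 by (intro mult_mono) auto
    then have "1 \<le> \<bar>\<xi> $ j\<bar>" by (simp add: n abs_mult)
    then show ?thesis by (rule self_le_power) simp
  qed (simp add: n)
  also have "\<dots> \<le> (norm \<xi>)\<^sup>2"
    by (intro power_mono component_le_norm_cart) auto
  finally show ?thesis .
qed

text \<open>The series of \<open>\<partial>\<^sub>i (div_inv h j)\<close>, differentiated termwise.\<close>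

definition grad_div_inv :: "(real^'m \<Rightarrow> real) \<Rightarrow> 'm \<Rightarrow> 'm \<Rightarrow> real^'m \<Rightarrow> real" where
  "grad_div_inv h i j x =
    Re (trig_series (\<lambda>\<xi>. fourier_coeff h \<xi> * complex_of_real (\<xi> $ i * \<xi> $ j / (norm \<xi>)\<^sup>2)) x)"

text \<open>The frequency 0 may be included in the sum, because the multiplier there is
  \<open>0 / 0 = 0\<close>.\<close>

lemma of_real_div_inv_trig_series:
  "complex_of_real (div_inv h j x) =
    trig_series (\<lambda>\<xi>. - \<i> * (fourier_coeff h \<xi> * complex_of_real (\<xi> $ j / (norm \<xi>)\<^sup>2))) x"
proof -
  show ?thesis
    unfolding of_real_div_inv div_inv_complex_def trig_series_def wave_def
      infsum_cmult_right' [symmetric] mult.assoc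
    by (rule infsum_cong_neutral) auto
qed

context
  fixes h :: "real^'m \<Rightarrow> real"
  assumes summable: "(\<lambda>\<xi>. norm (fourier_coeff h \<xi>)) summable_on freqs"
begin

lemma summable_div_inv_coeff:
  "(\<lambda>\<xi>. norm (- \<i> * (fourier_coeff h \<xi> * complex_of_real (\<xi> $ j / (norm \<xi>)\<^sup>2)))) summable_on freqs"
proof (rule Infinite_Sum.abs_summable_on_comparison_test' [OF summable])
  fix \<xi> :: "real^'m" assume "\<xi> \<in> freqs"
  then have "\<bar>\<xi> $ j\<bar> / (norm \<xi>)\<^sup>2 \<le> 1"
    using freqs_component_le [of \<xi> j] by (auto simp: divide_le_eq_1)
  then show "norm (- \<i> * (fourier_coeff h \<xi> * complex_of_real (\<xi> $ j / (norm \<xi>)\<^sup>2))) \<le> norm (fourier_coeff h \<xi>)"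
    unfolding norm_mult norm_of_real abs_divide by (simp add: mult_left_le del: times_divide_eq_right)
qed

lemma summable_grad_div_inv_coeff:
  "(\<lambda>\<xi>. norm (fourier_coeff h \<xi> * complex_of_real (\<xi> $ i * \<xi> $ j / (norm \<xi>)\<^sup>2))) summable_on freqs"
proof (rule Infinite_Sum.abs_summable_on_comparison_test' [OF summable])
  fix \<xi> :: "real^'m"
  have "\<bar>\<xi> $ i\<bar> * \<bar>\<xi> $ j\<bar> \<le> norm \<xi> * norm \<xi>"
    by (intro mult_mono component_le_norm_cart) auto
  then have "\<bar>\<xi> $ i\<bar> * \<bar>\<xi> $ j\<bar> / (norm \<xi>)\<^sup>2 \<le> 1"
    by (auto simp: divide_le_eq_1 power2_eq_square)
  then show "norm (fourier_coeff h \<xi> * complex_of_real (\<xi> $ i * \<xi> $ j / (norm \<xi>)\<^sup>2)) \<le> norm (fourier_coeff h \<xi>)"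
    unfolding norm_mult norm_of_real abs_divide abs_mult by (simp add: mult_left_le del: times_divide_eq_right)
qed

lemma continuous_on_div_inv: "continuous_on S (div_inv h j)"
proof -
  have "div_inv h j = (\<lambda>x. Re (complex_of_real (div_inv h j x)))" by simp
  then show ?thesis
    unfolding of_real_div_inv_trig_series
    by (simp only:) (intro continuous_on_Re continuous_on_trig_series summable_div_inv_coeff)
qed

lemma continuous_on_grad_div_inv: "continuous_on S (grad_div_inv h i j)"
  unfolding grad_div_inv_def
  by (intro continuous_on_Re continuous_on_trig_series summable_grad_div_inv_coeff)

text \<open>The weak form of the chain rule for the dilated \<open>div_inv h j\<close>. The
  derivative stays on the test function \<open>u\<close> until the series has been expanded, and is
  then moved onto single waves.\<close>

lemma integral_partial_mult_div_inv:
  assumes u: "C_diff 1 u" "periodic u"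
  shows "integral (cbox 0 1) (\<lambda>x. partial i u x * div_inv h j (real l *\<^sub>R x)) =
    - real l * integral (cbox 0 1) (\<lambda>x. u x * grad_div_inv h i j (real l *\<^sub>R x))"
proof -
  let ?a = "\<lambda>\<xi>. - \<i> * (fourier_coeff h \<xi> * complex_of_real (\<xi> $ j / (norm \<xi>)\<^sup>2))"
  let ?b = "\<lambda>\<xi>. fourier_coeff h \<xi> * complex_of_real (\<xi> $ i * \<xi> $ j / (norm \<xi>)\<^sup>2)"
  let ?I = "\<lambda>\<xi>. integral (cbox 0 1) (\<lambda>x. complex_of_real (u x) * wave \<xi> (real l *\<^sub>R x))"
  have cu: "continuous_on UNIV u" "continuous_on UNIV (partial i u)"
    using u C_diff_1_imp_continuous by auto
  have cts: "continuous_on UNIV (\<lambda>x. trig_series ?a (real l *\<^sub>R x))"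
    "continuous_on UNIV (\<lambda>x. trig_series ?b (real l *\<^sub>R x))"
    by (rule continuous_on_compose2 [OF continuous_on_trig_series [where S = UNIV]];
        intro summable_div_inv_coeff summable_grad_div_inv_coeff continuous_intros subset_UNIV)+
  have A: "((\<lambda>\<xi>. ?a \<xi> * integral (cbox 0 1) (\<lambda>x. complex_of_real (partial i u x) * wave \<xi> (real l *\<^sub>R x))) has_sum
      integral (cbox 0 1) (\<lambda>x. complex_of_real (partial i u x) * trig_series ?a (real l *\<^sub>R x))) freqs"
    by (intro has_sum_integral_trig_series summable_div_inv_coeff continuous_intros cu)
  have B: "((\<lambda>\<xi>. - complex_of_real (real l) * (?b \<xi> * ?I \<xi>)) has_sum - complex_of_real (real l) *
      integral (cbox 0 1) (\<lambda>x. complex_of_real (u x) * trig_series ?b (real l *\<^sub>R x))) freqs"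
    by (intro has_sum_cmult_right has_sum_integral_trig_series summable_grad_div_inv_coeff
        continuous_intros cu)
  \<comment> \<open>The wave has frequency \<open>l *\<^sub>R \<xi>\<close>, so integration by parts
    yields the factor \<open>- \<i> * l * \<xi> $ i\<close>; together with the \<open>- \<i>\<close>
    in \<open>?a\<close> this becomes \<open>- l * \<xi> $ i\<close>.\<close>
  have C: "?a \<xi> * integral (cbox 0 1) (\<lambda>x. complex_of_real (partial i u x) * wave \<xi> (real l *\<^sub>R x)) =
      - complex_of_real (real l) * (?b \<xi> * ?I \<xi>)" if "\<xi> \<in> freqs" for \<xi>
    using integral_partial_mult_wave [OF u freqs_scaleR_of_nat [OF that], of i l]
    by (simp add: wave_scaleR_right mult_ac)
  have eq: "integral (cbox 0 1) (\<lambda>x. complex_of_real (partial i u x) * trig_series ?a (real l *\<^sub>R x)) =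
      - complex_of_real (real l) * integral (cbox 0 1) (\<lambda>x. complex_of_real (u x) * trig_series ?b (real l *\<^sub>R x))"
    by (rule has_sum_unique [OF has_sum_cong [OF C, THEN iffD1, OF _ A] B])
  have Re_integral: "Re (integral (cbox 0 1) F) = integral (cbox 0 1) (\<lambda>x. Re (F x))"
    if "continuous_on UNIV F" for F :: "real^'m \<Rightarrow> complex"
    using integral_linear [OF integrable_on_cube [OF that] bounded_linear_Re] by (simp add: o_def)
  have "integral (cbox 0 1) (\<lambda>x. partial i u x * div_inv h j (real l *\<^sub>R x)) =
      Re (integral (cbox 0 1) (\<lambda>x. complex_of_real (partial i u x) * trig_series ?a (real l *\<^sub>R x)))"
    by (subst Re_integral, intro continuous_intros cu cts)
       (simp only: of_real_div_inv_trig_series [symmetric] of_real_mult [symmetric] Re_complex_of_real)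
  also have "\<dots> = - real l * Re (integral (cbox 0 1) (\<lambda>x. complex_of_real (u x) * trig_series ?b (real l *\<^sub>R x)))"
    unfolding eq by simp
  also have "Re (integral (cbox 0 1) (\<lambda>x. complex_of_real (u x) * trig_series ?b (real l *\<^sub>R x))) =
      integral (cbox 0 1) (\<lambda>x. u x * grad_div_inv h i j (real l *\<^sub>R x))"
    by (subst Re_integral, intro continuous_intros cu cts) (simp add: grad_div_inv_def)
  finally show ?thesis .
qed

text \<open>The divergence of \<open>div_inv h\<close> is \<open>h\<close>: the multipliers add up
  to 1 at every nonzero frequency and to 0 at the origin, where the coefficient vanishes anyway by
  the first assumption.\<close>

lemma sum_grad_div_inv:
  assumes "fourier_coeff h 0 = 0" "trig_series (fourier_coeff h) x = complex_of_real (h x)"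
  shows "(\<Sum>j\<in>UNIV. grad_div_inv h j j x) = h x"
proof -
  have "(\<Sum>j\<in>UNIV. grad_div_inv h j j x) =
      Re (trig_series (\<lambda>\<xi>. \<Sum>j\<in>UNIV. fourier_coeff h \<xi> * complex_of_real (\<xi> $ j * \<xi> $ j / (norm \<xi>)\<^sup>2)) x)"
    unfolding grad_div_inv_def
    by (subst trig_series_sum [symmetric]) (simp_all add: summable_grad_div_inv_coeff del: of_real_divide of_real_mult)
  also have "trig_series (\<lambda>\<xi>. \<Sum>j\<in>UNIV. fourier_coeff h \<xi> * complex_of_real (\<xi> $ j * \<xi> $ j / (norm \<xi>)\<^sup>2)) x =
      trig_series (fourier_coeff h) x"
  proof (rule trig_series_cong)
    fix \<xi> :: "real^'m"
    have "(\<Sum>j\<in>UNIV. fourier_coeff h \<xi> * complex_of_real (\<xi> $ j * \<xi> $ j / (norm \<xi>)\<^sup>2)) =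
        fourier_coeff h \<xi> * complex_of_real ((\<xi> \<bullet> \<xi>) / (norm \<xi>)\<^sup>2)"
      by (simp only: inner_vec_def inner_real_def sum_divide_distrib of_real_sum sum_distrib_left)
    also have "\<dots> = fourier_coeff h \<xi>"
      using assms(1) by (cases "\<xi> = 0") (auto simp: power2_norm_eq_inner)
    finally show "(\<Sum>j\<in>UNIV. fourier_coeff h \<xi> * complex_of_real (\<xi> $ j * \<xi> $ j / (norm \<xi>)\<^sup>2)) =
        fourier_coeff h \<xi>" .
  qed
  finally show ?thesis by (simp add: assms(2))
qed

end

text \<open>The multiplier contains the factor \<open>\<xi> $ i * \<xi> $ j\<close>, so each term
  vanishes through its multiplier or through its coefficient.\<close>

lemma grad_div_inv_eq_0:
  assumes "\<And>\<xi>. \<lbrakk>\<xi> \<in> freqs; \<xi> $ i \<noteq> 0; \<xi> $ j \<noteq> 0\<rbrakk> \<Longrightarrow> fourier_coeff h \<xi> = 0"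
  shows "grad_div_inv h i j x = 0"
proof -
  have "grad_div_inv h i j x = Re (trig_series (\<lambda>\<xi>. 0) x)"
    unfolding grad_div_inv_def by (rule arg_cong [OF trig_series_cong]) (use assms in auto)
  then show ?thesis by (simp add: trig_series_def)
qed

text \<open>Equal cardinalities keep the ranks within the list and make them pick distinct
  coordinates. Afterwards only an injection \<open>s\<close> avoiding \<alpha> is used, no longer
  the orderings.\<close>

lemma drop_coords_eq:
  assumes card: "CARD('n::{finite,linorder}) = card (- set \<alpha> :: 'd::{finite,linorder} set)"
  shows "\<exists>s :: 'n \<Rightarrow> 'd. inj s \<and> range s \<inter> set \<alpha> = {} \<and> drop_coords \<alpha> = (\<lambda>x. \<chi> j. x $ s j)"
proof -
  let ?xs = "sorted_list_of_set (- set \<alpha>)"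
  let ?r = "\<lambda>i :: 'n. card {j. j < i}"
  have r: "?r i < length ?xs" for i
    using psubset_card_mono [of UNIV "{j. j < i}"] card by auto
  have "?r i < ?r j" if "i < j" for i j
    by (rule psubset_card_mono) (use that in auto)
  then have inj_r: "?r i = ?r j \<Longrightarrow> i = j" for i j
    by (metis less_irrefl linorder_less_linear)
  have "inj (\<lambda>i. ?xs ! ?r i)"
    by (rule injI) (use r inj_r in \<open>auto simp: nth_eq_iff_index_eq simp del: length_sorted_list_of_set\<close>)
  moreover have "?xs ! ?r i \<notin> set \<alpha>" for i
    using nth_mem [OF r [of i]] by simp
  ultimately show ?thesis
    by (intro exI [of _ "\<lambda>i. ?xs ! ?r i"]) (auto simp: drop_coords_def fun_eq_iff)
qed


section \<open>The homotopy identity\<close>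

lemma integral_double_sum_scaled:
  fixes F :: "'d::finite \<Rightarrow> 'd \<Rightarrow> real^'d \<Rightarrow> real"
  assumes "\<And>i j. continuous_on UNIV (F i j)"
  shows "integral (cbox 0 1) (\<lambda>x. c * (\<Sum>i\<in>UNIV. \<Sum>j\<in>UNIV. F i j x)) =
    c * (\<Sum>i\<in>UNIV. \<Sum>j\<in>UNIV. integral (cbox 0 1) (F i j))"
proof -
  have "integral (cbox 0 1) (\<lambda>x. \<Sum>i\<in>UNIV. \<Sum>j\<in>UNIV. F i j x) =
      (\<Sum>i\<in>UNIV. integral (cbox 0 1) (\<lambda>x. \<Sum>j\<in>UNIV. F i j x))"
    by (intro integral_sum integrable_on_cube continuous_on_sum assms) auto
  also have "\<dots> = (\<Sum>i\<in>UNIV. \<Sum>j\<in>UNIV. integral (cbox 0 1) (F i j))"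
    by (intro sum.cong refl integral_sum integrable_on_cube assms) auto
  finally show ?thesis by simp
qed

text \<open>The signs come from the conventions for \<open>contract\<close> and
  \<open>boundary\<close>: the identity reads \<open>U - V = \<partial>W\<close> for odd
  \<open>m\<close> and \<open>U + V = - \<partial>W\<close> for even \<open>m\<close>. Equality of
  currents is tested on forms of degree \<open>m\<close>, the common degree of \<open>U\<close> and
  \<open>V\<close>.\<close>

theorem proposition5p2:
  fixes k m l :: nat
    and \<alpha> \<beta> :: "'d::{finite,linorder} list"
    and g :: "real^'n::{finite,linorder} \<Rightarrow> real"
    and f g\<^sub>\<alpha> :: "(real, 'd) vec \<Rightarrow> real"
    and G\<^sub>\<alpha> :: "'d \<Rightarrow> (real, 'd) vec \<Rightarrow> real"
    and U V W :: "(real, 'd) vec \<Rightarrow> 'd multivector"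
  assumes "k + 2 \<le> CARD('d)"
    and "CARD('n) = CARD('d) - (k + 1)"
    and "\<alpha> \<in> multi_indices (k + 1)"
    and "smooth g" and "periodic g" and "torus_integral g = 0"
    and "g\<^sub>\<alpha> = (\<lambda>x. g (drop_coords \<alpha> x))"
    and "G\<^sub>\<alpha> = div_inv g\<^sub>\<alpha>"
    and "\<beta> \<in> multi_indices m" and "set \<beta> \<subseteq> set \<alpha>"
    and "smooth f" and "periodic f"
    and "l \<ge> 1"
    and "U = (\<lambda>x. (f x * dilate l g\<^sub>\<alpha> x) *\<^sub>R e_multi \<beta>)"
    and "V = (\<lambda>x. (1 / real l) *\<^sub>R (\<Sum>i\<in>UNIV. \<Sum>j\<in>UNIV.
                 (partial i f x * dilate l (G\<^sub>\<alpha> j) x) *\<^sub>R contract (e_multi \<beta> \<and>\<^sub>e e_vec j) i))"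
    and "W = (\<lambda>x. (1 / real l) *\<^sub>R (\<Sum>j\<in>UNIV.
                 (f x * dilate l (G\<^sub>\<alpha> j) x) *\<^sub>R (e_multi \<beta> \<and>\<^sub>e e_vec j)))"
  shows "\<forall>\<omega>\<in>test_forms m.
           current_of (\<lambda>x. U x + (- 1) ^ m *\<^sub>R V x) \<omega> =
           boundary (current_of (\<lambda>x. (- 1) ^ (m + 1) *\<^sub>R W x)) \<omega>"
proof
  fix \<omega> :: "'d form" assume "\<omega> \<in> test_forms m"
  then have \<omega>: "smooth \<omega>" "periodic \<omega>" by (auto simp: test_forms_def)
  define \<tau> where "\<tau> j = e_multi \<beta> \<and>\<^sub>e e_vec j" for j
  define \<kappa> where "\<kappa> i j = contract (\<tau> j) i" for i j
  define Q where "Q = grad_div_inv g\<^sub>\<alpha>"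
  let ?c = "\<lambda>x. real l *\<^sub>R x"
  let ?s = "(- 1 :: real) ^ m"

  have \<alpha>: "sorted_wrt (<) \<alpha>" "length \<alpha> = k + 1" and \<beta>: "sorted_wrt (<) \<beta>" "length \<beta> = m"
    using assms(3,9) by (auto simp: multi_indices_def)
  then have "distinct \<alpha>" "distinct \<beta>"
    by (simp_all add: strict_sorted_iff)
  then have card: "CARD('n) = card (- set \<alpha>)" "card (set \<beta>) = m"
    using \<alpha> \<beta> assms(2) by (simp_all add: Compl_eq_Diff_UNIV card_Diff_subset distinct_card)
  obtain s :: "'n \<Rightarrow> 'd" where s: "inj s" "range s \<inter> set \<alpha> = {}"
    and drop: "drop_coords \<alpha> = (\<lambda>x. \<chi> j. x $ s j)"
    using drop_coords_eq [OF card(1)] by blast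
  have g\<^sub>\<alpha>: "g\<^sub>\<alpha> = (\<lambda>x. g (\<chi> j. x $ s j))"
    using assms(7) by (simp add: drop)
  have summable: "(\<lambda>\<xi>. norm (fourier_coeff g\<^sub>\<alpha> \<xi>)) summable_on freqs"
    unfolding g\<^sub>\<alpha> by (rule summable_fourier_coeff_pullback [OF assms(4,5) s(1)])
  have "fourier_coeff g\<^sub>\<alpha> 0 = 0"
    using fourier_coeff_pullback_0 [OF assms(4,5) s(1)] fourier_coeff_0 [OF smooth_imp_continuous [OF assms(4)]]
    by (simp add: g\<^sub>\<alpha> assms(6))
  moreover have series: "trig_series (fourier_coeff g\<^sub>\<alpha>) x = complex_of_real (g\<^sub>\<alpha> x)" for x
    unfolding g\<^sub>\<alpha> by (rule trig_series_pullback [OF assms(4,5) s(1)])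
  ultimately have trace: "(\<Sum>j\<in>UNIV. Q j j x) = g\<^sub>\<alpha> x" for x
    unfolding Q_def by (intro sum_grad_div_inv summable)
  have Q_eq_0: "Q i j x = 0" if "i \<in> set \<alpha> \<or> j \<in> set \<alpha>" for i j x
    unfolding Q_def
  proof (rule grad_div_inv_eq_0)
    fix \<xi> :: "(real, 'd) vec" assume "\<xi> \<in> freqs" "\<xi> $ i \<noteq> 0" "\<xi> $ j \<noteq> 0"
    moreover have "i \<notin> range s \<or> j \<notin> range s" using that s(2) by auto
    ultimately show "fourier_coeff g\<^sub>\<alpha> \<xi> = 0"
      unfolding g\<^sub>\<alpha> using fourier_coeff_pullback_eq_0 [OF assms(4,5) s(1)] by metis
  qed
  \<comment> \<open>Off the diagonal \<open>\<kappa> i j\<close> alone need not vanish, for instance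
    when \<open>i\<close> belongs to \<beta>; in that case \<open>Q i j\<close> does.\<close>
  have Q\<kappa>: "Q i j x *\<^sub>R \<kappa> i j = (if i = j then (?s * Q j j x) *\<^sub>R e_multi \<beta> else 0)" for i j x
  proof (cases "i \<in> set \<alpha> \<or> j \<in> set \<alpha>")
    case True
    then show ?thesis using Q_eq_0 [of i j x] by auto
  next
    case False
    then have "i \<notin> set \<beta>" "j \<notin> set \<beta>" using assms(10) by auto
    then show ?thesis
      by (simp add: \<kappa>_def \<tau>_def e_multi_sorted [OF \<beta>(1)] contract_wedge_e_vec card(2))
  qed

  \<comment> \<open>Continuity is read off the absolutely convergent series.\<close>
  have "(\<lambda>x. complex_of_real (g\<^sub>\<alpha> x)) = trig_series (fourier_coeff g\<^sub>\<alpha>)"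
    by (simp add: fun_eq_iff series)
  then have "continuous_on UNIV (\<lambda>x. Re (complex_of_real (g\<^sub>\<alpha> x)))"
    using continuous_on_trig_series [OF summable] by (simp only: continuous_on_Re)
  then have cont_g: "continuous_on UNIV g\<^sub>\<alpha>" by simp
  have dilate: "continuous_on UNIV (\<lambda>x. u (?c x))" if "continuous_on UNIV u" for u :: "(real, 'd) vec \<Rightarrow> real"
    by (rule continuous_on_compose2 [OF that]) (auto intro!: continuous_intros)
  note cont [continuous_intros] =
    smooth_imp_continuous [OF assms(11)] smooth_imp_continuous [OF smooth_partial [OF assms(11)]]
    smooth_imp_continuous [OF \<omega>(1)] smooth_imp_continuous [OF smooth_partial [OF \<omega>(1)]]
    dilate [OF cont_g] dilate [OF continuous_on_div_inv [OF summable]]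
    dilate [OF continuous_on_grad_div_inv [OF summable, folded Q_def]]

  \<comment> \<open>The scalar test function for the weak derivative of the dilated
    \<open>G\<^sub>\<alpha> j\<close>.\<close>
  define u where "u i j x = f x * (\<omega> x \<bullet> \<kappa> i j)" for i j x
  have smooth1: "C_diff 1 f" "C_diff 1 \<omega>" by (intro smooth_imp_C_diff_1 assms(11) \<omega>(1))+
  have \<omega>\<kappa>: "C_diff 1 (\<lambda>x. \<omega> x \<bullet> \<kappa> i j)" "partial i' (\<lambda>x. \<omega> x \<bullet> \<kappa> i j) x = partial i' \<omega> x \<bullet> \<kappa> i j" for i j i' x
    subgoal by (rule C_diff_1_bounded_linear [OF bounded_linear_inner_left smooth1(2)])
    subgoal by (rule partial_bounded_linear [OF bounded_linear_inner_left])
        (use smooth1(2) in \<open>simp add: C_diff_1\<close>)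
    done
  have u: "C_diff 1 (u i j)" "periodic (u i j)" for i j
    unfolding u_def
    subgoal by (rule C_diff_1_bilinear [OF bounded_bilinear_mult smooth1(1) \<omega>\<kappa>(1)])
    subgoal using assms(12) \<omega>(2) by (simp add: periodic_def)
    done
  have partial_u: "partial i (u i j) x = f x * (partial i \<omega> x \<bullet> \<kappa> i j) + partial i f x * (\<omega> x \<bullet> \<kappa> i j)" for i j x
    unfolding u_def
    using partial_bilinear [OF bounded_bilinear_mult, of f x "\<lambda>x. \<omega> x \<bullet> \<kappa> i j" i] smooth1(1) \<omega>\<kappa>
    unfolding C_diff_1 by simp

  \<comment> \<open>Up to constants, \<open>A\<close> is the integrand of the boundary term, with
    the derivative on the form, \<open>B\<close> that of \<open>V\<close>, with the derivative on
    \<open>f\<close>, and \<open>D\<close> has the derivative on \<open>G\<^sub>\<alpha> j\<close>.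
    The product rule for \<open>u\<close> turns \<open>A + B\<close> into the left side of the weak
    chain rule.\<close>
  define A where "A i j x = f x * (partial i \<omega> x \<bullet> \<kappa> i j) * G\<^sub>\<alpha> j (?c x)" for i j x
  define B where "B i j x = partial i f x * (\<omega> x \<bullet> \<kappa> i j) * G\<^sub>\<alpha> j (?c x)" for i j x
  define D where "D i j x = u i j x * Q i j (?c x)" for i j x
  let ?P = "\<lambda>x. f x * (\<omega> x \<bullet> e_multi \<beta>) * g\<^sub>\<alpha> (?c x)"
  let ?I = "\<lambda>F :: (real, 'd) vec \<Rightarrow> real. integral (cbox 0 1) F"
  have contABD [continuous_intros]:
    "continuous_on UNIV (A i j)" "continuous_on UNIV (B i j)" "continuous_on UNIV (D i j)" for i j
    unfolding A_def B_def D_def u_def assms(8) by (intro continuous_intros)+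
  have contP [continuous_intros]: "continuous_on UNIV ?P"
    by (intro continuous_intros)

  have AB: "?I (A i j) = - real l * ?I (D i j) - ?I (B i j)" for i j
  proof -
    have "?I (A i j) + ?I (B i j) = ?I (\<lambda>x. A i j x + B i j x)"
      by (intro integral_add [symmetric] integrable_on_cube contABD)
    also have "\<dots> = ?I (\<lambda>x. partial i (u i j) x * div_inv g\<^sub>\<alpha> j (?c x))"
      by (simp add: A_def B_def partial_u assms(8) distrib_right)
    also have "\<dots> = - real l * ?I (D i j)"
      using integral_partial_mult_div_inv [OF summable u] by (simp add: D_def [abs_def] Q_def)
    finally show ?thesis by simp
  qed
  \<comment> \<open>The off-diagonal terms drop out by \<open>Q\<kappa>\<close>, and the diagonal
    ones add up through \<open>trace\<close> to \<open>?P\<close>, the integrand of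
    \<open>U\<close>.\<close>
  have sum_D: "(\<Sum>i\<in>UNIV. \<Sum>j\<in>UNIV. ?I (D i j)) = ?s * ?I ?P"
  proof -
    have "D i j x = (if i = j then ?s * (f x * (\<omega> x \<bullet> e_multi \<beta>) * Q j j (?c x)) else 0)" for i j x
    proof -
      have "D i j x = f x * (\<omega> x \<bullet> (Q i j (?c x) *\<^sub>R \<kappa> i j))"
        by (simp add: D_def u_def)
      then show ?thesis unfolding Q\<kappa> by simp
    qed
    then have "(\<Sum>i\<in>UNIV. \<Sum>j\<in>UNIV. D i j x) =
        ?s * (f x * (\<omega> x \<bullet> e_multi \<beta>) * (\<Sum>j\<in>UNIV. Q j j (?c x)))" for x
      by (simp add: sum_distrib_left)
    then have "(\<Sum>i\<in>UNIV. \<Sum>j\<in>UNIV. D i j x) = ?s * ?P x" for x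
      by (simp only: trace)
    then show ?thesis
      using integral_double_sum_scaled [of D 1] by (simp add: contABD)
  qed

  have contUW: "continuous_on UNIV (\<lambda>x. \<omega> x \<bullet> (U x + ?s *\<^sub>R V x))"
      "continuous_on UNIV (\<lambda>x. ext_deriv \<omega> x \<bullet> ((- 1) ^ (m + 1) *\<^sub>R W x))"
    and UV: "\<omega> x \<bullet> (U x + ?s *\<^sub>R V x) = ?P x + ?s / real l * (\<Sum>i\<in>UNIV. \<Sum>j\<in>UNIV. B i j x)"
    and W: "ext_deriv \<omega> x \<bullet> ((- 1) ^ (m + 1) *\<^sub>R W x) = - ?s / real l * (\<Sum>i\<in>UNIV. \<Sum>j\<in>UNIV. A i j x)" for x
  proof -
    show UV: "\<omega> x \<bullet> (U x + ?s *\<^sub>R V x) = ?P x + ?s / real l * (\<Sum>i\<in>UNIV. \<Sum>j\<in>UNIV. B i j x)" for x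
      unfolding assms(14,15) B_def dilate_def \<kappa>_def \<tau>_def
      by (simp add: inner_add_right inner_sum_right mult_ac)
    \<comment> \<open>By \<open>inner_contract\<close> the wedge with \<open>dx i\<close> in the
      exterior derivative becomes the contraction \<open>\<kappa> i j\<close> on the side of the
      multivector.\<close>
    show W: "ext_deriv \<omega> x \<bullet> ((- 1) ^ (m + 1) *\<^sub>R W x) = - ?s / real l * (\<Sum>i\<in>UNIV. \<Sum>j\<in>UNIV. A i j x)" for x
      unfolding assms(16) A_def dilate_def \<kappa>_def inner_contract \<tau>_def ext_deriv_def
      by (simp add: inner_sum_right inner_sum_left sum_distrib_left mult_ac)
        (subst sum.swap, simp add: sum_negf)
    show "continuous_on UNIV (\<lambda>x. \<omega> x \<bullet> (U x + ?s *\<^sub>R V x))"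
      unfolding UV by (intro continuous_intros)
    show "continuous_on UNIV (\<lambda>x. ext_deriv \<omega> x \<bullet> ((- 1) ^ (m + 1) *\<^sub>R W x))"
      unfolding W by (intro continuous_intros)
  qed
  have "current_of (\<lambda>x. U x + ?s *\<^sub>R V x) \<omega> = ?I (\<lambda>x. ?P x + ?s / real l * (\<Sum>i\<in>UNIV. \<Sum>j\<in>UNIV. B i j x))"
    unfolding current_of_def UV by (rule torus_integral_eq_integral [OF contUW(1), unfolded UV])
  also have "\<dots> = ?I ?P + ?s / real l * (\<Sum>i\<in>UNIV. \<Sum>j\<in>UNIV. ?I (B i j))"
    by (subst integral_add, (intro integrable_on_cube continuous_intros)+)
       (simp only: integral_double_sum_scaled [OF contABD(2)])
  also have "\<dots> = - ?s / real l * (\<Sum>i\<in>UNIV. \<Sum>j\<in>UNIV. ?I (A i j))"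
  proof -
    have "(\<Sum>i\<in>UNIV. \<Sum>j\<in>UNIV. ?I (A i j)) =
        - real l * (?s * ?I ?P) - (\<Sum>i\<in>UNIV. \<Sum>j\<in>UNIV. ?I (B i j))"
      unfolding AB sum_D [symmetric] by (simp add: sum_subtractf sum_distrib_left sum_negf)
    moreover have "?s * ?s = 1" by (simp flip: power_add add: mult_2 [symmetric])
    \<comment> \<open>Here \<open>r\<close> is the sign \<open>(- 1) ^ m\<close> and
      \<open>c\<close> is \<open>l\<close>; the sign squared restores the coefficient 1 of
      \<open>?I ?P\<close>.\<close>
    moreover have "p + r / c * b = - r / c * a" if "a = - c * (r * p) - b" "r * r = 1" "c \<noteq> 0"
      for a b c p r :: real
    proof -
      have "- r / c * a = r * r * p + r / c * b"
        using that(3) by (simp add: that(1) field_simps)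
      then show ?thesis by (simp add: that(2))
    qed
    ultimately show ?thesis using assms(13) by simp
  qed
  also have "\<dots> = ?I (\<lambda>x. - ?s / real l * (\<Sum>i\<in>UNIV. \<Sum>j\<in>UNIV. A i j x))"
    by (rule integral_double_sum_scaled [OF contABD(1), symmetric])
  also have "\<dots> = boundary (current_of (\<lambda>x. (- 1) ^ (m + 1) *\<^sub>R W x)) \<omega>"
    unfolding boundary_def current_of_def W
    by (rule torus_integral_eq_integral [OF contUW(2), unfolded W, symmetric])
  finally show "current_of (\<lambda>x. U x + ?s *\<^sub>R V x) \<omega> =
      boundary (current_of (\<lambda>x. (- 1) ^ (m + 1) *\<^sub>R W x)) \<omega>" .
qed

end
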